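(* For any $n$-dimensional convex polytope $P$ with $m$ facets, the simplicial complex $K_P$ is a reduced $P$-complex of rank $n$. Moreover, $F(K_P)=G_P$ as subsets of $2^{[m]}$, and $F(K_P)$ (ordered by inclusion) is isomorphic as a graded poset to the set of faces of $P$ ordered by reverse inclusion.
   Context: Let $P$ be an $n$-dimensional convex polytope (not necessarily simple) with facets $\mathcal{F}_1,\dots,\mathcal{F}_m$; $[m]=\{1,\dots,m\}$. Faces of $P$ are the nonempty faces, including $P$ itself. For a face $F$ put $\tilde\sigma(F)=\{i\in[m]\mid F\subseteq\mathcal{F}_i\}$. The hypergraph $G_P\subseteq 2^{[m]}$ is the image of $\tilde\sigma$ (equivalently, the set of all subsets $\{i\mid x\in\mathcal{F}_i\}$ for $x\in P$). $K_P$ is the simplicial closure of $G_P$, i.e. the smallest simplicial complex containing $G_P$; equivalently $\{i_1,\dots,i_k\}\in K_P$ iff $\mathcal{F}_{i_1}\cap\dots\cap\mathcal{F}_{i_k}\ne\varnothing$. For a finite simplicial complex $K$, let $M(K)$ be the set of its inclusion-maximal simplices. A simplex $\tau\in K$ is a face simplex if $\tau=\sigma_1\cap\dots\cap\sigma_s$ for some $\sigma_1,\dots,\sigma_s\in M(K)$ ($s\ge1$). $F(K)$ denotes the set of all face simplices, ordered by inclusion. $K$ is called a polytopic complex ($P$-complex) of rank $n$ if: (1) $\varnothing\in F(K)$, i.e. the intersection of all maximal simplices is empty; (2) $F(K)$ is a graded poset of rank $n$, i.e. all its inclusion-maximal chains have the same number $n+1$ of elements, so that a rank function $\mathrm{rk}$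 is defined with $\mathrm{rk}(\varnothing)=0$, with $\mathrm{rk}$ increasing by $1$ along covering relations, and with $\mathrm{rk}(\sigma)=n$ for maximal simplices $\sigma$; (3) for every $\sigma\in F(K)$ there is a simplicial subcomplex $Z_\sigma$ of $\mathrm{link}_K\sigma$ such that (the geometric realization of) $Z_\sigma$ is homeomorphic to the sphere $S^{n-\mathrm{rk}(\sigma)-1}$ and $Z_\sigma$ is a strong deformation retract of $\mathrm{link}_K\sigma$; here $\mathrm{link}_K\varnothing=K$ and $S^{-1}=\varnothing$. A $P$-complex $K$ is reduced if $\{v\}\in F(K)$ for every vertex $v$ of $K$. *)

theory Defs
  imports "HOL-Analysis.Analysis"
begin

section \<open>Finite abstract simplicial complexes\<close>

text \<open>The empty simplex belongs to every complex; the complex without vertices is \<open>{{}}\<close>.\<close>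

definition abs_complex :: "'v set set \<Rightarrow> bool" where
  "abs_complex K \<longleftrightarrow> finite K \<and> {} \<in> K \<and> (\<forall>\<sigma>\<in>K. finite \<sigma> \<and> (\<forall>\<tau>. \<tau> \<subseteq> \<sigma> \<longrightarrow> \<tau> \<in> K))"

definition vertices :: "'v set set \<Rightarrow> 'v set" where
  "vertices K = {v. {v} \<in> K}"

definition link :: "'v set set \<Rightarrow> 'v set \<Rightarrow> 'v set set" where
  "link K \<sigma> = {\<tau> \<in> K. \<tau> \<inter> \<sigma> = {} \<and> \<tau> \<union> \<sigma> \<in> K}"

definition max_simplices :: "'v set set \<Rightarrow> 'v set set" where
  "max_simplices K = {\<sigma> \<in> K. \<forall>\<tau>\<in>K. \<sigma> \<subseteq> \<tau> \<longrightarrow> \<tau> = \<sigma>}"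

definition face_simplices :: "'v set set \<Rightarrow> 'v set set" where
  "face_simplices K =
     {\<tau> \<in> K. \<exists>S. S \<subseteq> max_simplices K \<and> finite S \<and> S \<noteq> {} \<and> \<tau> = \<Inter>S}"

text \<open>
  The geometric realization, in barycentric coordinates. A complex here has only finitely many
  vertices, so the product topology on all coordinates induces the usual topology.
\<close>

definition geom_carrier :: "'v set set \<Rightarrow> ('v \<Rightarrow> real) set" where
  "geom_carrier K =
     {x. (\<forall>v. 0 \<le> x v) \<and> {v. x v \<noteq> 0} \<in> K \<and> (\<Sum>v\<in>{v. x v \<noteq> 0}. x v) = 1}"

definition geom_realization :: "'v set set \<Rightarrow> ('v \<Rightarrow> real) topology" where
  "geom_realization K = subtopology (powertop_real UNIV) (geom_carrier K)"


section \<open>Spheres and strong deformation retracts\<close>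

text \<open>
  Spheres indexed by an integer dimension, in order to include the empty sphere of dimension
  \<open>-1\<close>; the value for dimensions below \<open>-1\<close> is irrelevant.
\<close>

definition sphere_space :: "int \<Rightarrow> (nat \<Rightarrow> real) topology" where
  "sphere_space d = (if d < 0 then discrete_topology {} else nsphere (nat d))"

text \<open>
  Every stage of the homotopy from the identity to \<open>r\<close> fixes \<open>A\<close> pointwise, that is, the
  homotopy is relative to \<open>A\<close>; in particular \<open>r\<close> is a retraction onto \<open>A\<close>.
\<close>

definition strong_deformation_retract_of :: "'a set \<Rightarrow> 'a topology \<Rightarrow> bool"
    (infix \<open>strong'_deformation'_retract'_of\<close> 50) where
  "A strong_deformation_retract_of X \<longleftrightarrow>
     A \<subseteq> topspace X \<and>
     (\<exists>r. r ` topspace X \<subseteq> A \<and> homotopic_with (\<lambda>h. \<forall>x\<in>A. h x = x) X X id r)"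


section \<open>Graded posets\<close>

text \<open>A poset is given by its carrier and its strict order, as in \<^theory>\<open>HOL.Zorn\<close>.\<close>

definition covers :: "'a set \<Rightarrow> ('a \<Rightarrow> 'a \<Rightarrow> bool) \<Rightarrow> 'a \<Rightarrow> 'a \<Rightarrow> bool" where
  "covers A lt x y \<longleftrightarrow> x \<in> A \<and> y \<in> A \<and> lt x y \<and> (\<nexists>z. z \<in> A \<and> lt x z \<and> lt z y)"

definition graded_poset :: "'a set \<Rightarrow> ('a \<Rightarrow> 'a \<Rightarrow> bool) \<Rightarrow> nat \<Rightarrow> bool" where
  "graded_poset A lt n \<longleftrightarrow>
     irreflp_on A lt \<and> transp_on A lt \<and> (\<forall>C. pred_on.maxchain A lt C \<longrightarrow> card C = n + 1)"

text \<open>On a graded poset of rank \<open>n\<close> these conditions determine \<open>rk\<close> uniquely.\<close>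

definition rank_function :: "'a set \<Rightarrow> ('a \<Rightarrow> 'a \<Rightarrow> bool) \<Rightarrow> nat \<Rightarrow> ('a \<Rightarrow> nat) \<Rightarrow> bool" where
  "rank_function A lt n rk \<longleftrightarrow>
     (\<forall>x\<in>A. (\<nexists>y. y \<in> A \<and> lt y x) \<longrightarrow> rk x = 0) \<and>
     (\<forall>x y. covers A lt x y \<longrightarrow> rk y = rk x + 1) \<and>
     (\<forall>x\<in>A. (\<nexists>y. y \<in> A \<and> lt x y) \<longrightarrow> rk x = n)"

definition graded_poset_isomorphic ::
    "nat \<Rightarrow> 'a set \<Rightarrow> ('a \<Rightarrow> 'a \<Rightarrow> bool) \<Rightarrow> 'b set \<Rightarrow> ('b \<Rightarrow> 'b \<Rightarrow> bool) \<Rightarrow> bool" where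
  "graded_poset_isomorphic n A ltA B ltB \<longleftrightarrow>
     graded_poset A ltA n \<and> graded_poset B ltB n \<and>
     (\<exists>rkA rkB f. rank_function A ltA n rkA \<and> rank_function B ltB n rkB \<and>
        bij_betw f A B \<and>
        (\<forall>x\<in>A. \<forall>y\<in>A. ltA x y \<longleftrightarrow> ltB (f x) (f y)) \<and>
        (\<forall>x\<in>A. rkB (f x) = rkA x))"


section \<open>Polytopic complexes\<close>

definition polytopic_complex :: "nat \<Rightarrow> 'v set set \<Rightarrow> bool" where
  "polytopic_complex n K \<longleftrightarrow>
     abs_complex K \<and>
     {} \<in> face_simplices K \<and>
     graded_poset (face_simplices K) (\<subset>) n \<and>
     (\<exists>rk. rank_function (face_simplices K) (\<subset>) n rk \<and>
        (\<forall>\<sigma>\<in>face_simplices K. \<exists>Z. abs_complex Z \<and> Z \<subseteq> link K \<sigma> \<and>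
           geom_realization Z homeomorphic_space sphere_space (int n - int (rk \<sigma>) - 1) \<and>
           geom_carrier Z strong_deformation_retract_of geom_realization (link K \<sigma>)))"

definition reduced_complex :: "'v set set \<Rightarrow> bool" where
  "reduced_complex K \<longleftrightarrow> (\<forall>v\<in>vertices K. {v} \<in> face_simplices K)"


section \<open>The complex of a polytope\<close>

text \<open>
  Unlike \<^const>\<open>face_of\<close>, faces are required to be nonempty; the polytope itself is a face.
  The facets are enumerated as \<open>\<F> 1, \<dots>, \<F> m\<close>.
\<close>

definition faces :: "'a::euclidean_space set \<Rightarrow> 'a set set" where
  "faces P = {F. F face_of P \<and> F \<noteq> {}}"

definition facet_indices :: "nat \<Rightarrow> (nat \<Rightarrow> 'a set) \<Rightarrow> 'a set \<Rightarrow> nat set" where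
  "facet_indices m \<F> F = {i \<in> {1..m}. F \<subseteq> \<F> i}"

definition polytope_hypergraph ::
    "'a::euclidean_space set \<Rightarrow> nat \<Rightarrow> (nat \<Rightarrow> 'a set) \<Rightarrow> nat set set" where
  "polytope_hypergraph P m \<F> = facet_indices m \<F> ` faces P"

definition polytope_complex ::
    "'a::euclidean_space set \<Rightarrow> nat \<Rightarrow> (nat \<Rightarrow> 'a set) \<Rightarrow> nat set set" where
  "polytope_complex P m \<F> = abs_complex hull polytope_hypergraph P m \<F>"

end

theory Submission
  imports Defs
begin

text \<open>
  The maximal simplices of \<open>K\<^sub>P\<close> are the sets \<open>{i. v \<in> \<F> i}\<close> for the vertices \<open>v\<close> of \<open>P\<close>, and
  faces are determined by the facets containing them; this gives \<open>F(K\<^sub>P) = G\<^sub>P\<close> and the order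
  isomorphism, and grading by codimension works because a proper face of \<open>F\<close> lies in a facet of \<open>F\<close>.

  The link of \<open>\<sigma>(F)\<close> is the nerve of the cover of the relative boundary of \<open>F\<close> by the sets
  \<open>F \<inter> \<F> i\<close>. Fix \<open>c\<close> in the relative interior of \<open>F\<close> and write the inequality of \<open>\<F> i\<close> on \<open>F\<close> as
  \<open>w i \<bullet> (x - c) \<le> 1\<close>. The linear map \<open>\<phi>\<close> sending vertex \<open>i\<close> to \<open>w i\<close> maps the realization of the
  nerve onto the boundary \<open>B\<close> of the polar dual of \<open>F - c\<close>, a sphere of dimension \<open>dim F - 1\<close>, and
  a point of the full simplex lies in the nerve iff its image lies in \<open>B\<close>. The subcomplex \<open>Z\<close>
  consists of the simplices all of whose points are lexicographically maximal in their fibre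
  (a pulling triangulation of \<open>B\<close>). Each fibre contains exactly one maximal point, so \<open>\<phi>\<close> is a
  homeomorphism from \<open>Z\<close> onto \<open>B\<close>. Moving each point linearly to the maximal point of its fibre
  stays within the fibre and is the required deformation.
\<close>

section \<open>Lexicographically maximal points\<close>

text \<open>Smaller indices take precedence and coordinates outside \<open>I\<close> are ignored.
  This loses nothing on the simplex over \<open>I\<close>, whose points vanish there.\<close>

definition lex_less :: "nat set \<Rightarrow> (nat \<Rightarrow> real) \<Rightarrow> (nat \<Rightarrow> real) \<Rightarrow> bool" where
  "lex_less I x y \<longleftrightarrow> (\<exists>i\<in>I. x i < y i \<and> (\<forall>j\<in>I. j < i \<longrightarrow> x j = y j))"

lemma lex_less_total:
  assumes "finite I" "\<exists>i\<in>I. x i \<noteq> y i"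
  shows "lex_less I x y \<or> lex_less I y x"
proof -
  define i where "i = (LEAST i. i \<in> I \<and> x i \<noteq> y i)"
  have "i \<in> I \<and> x i \<noteq> y i"
    unfolding i_def using assms(2) by (metis (mono_tags, lifting) LeastI)
  moreover have "x j = y j" if "j \<in> I" "j < i" for j
    using that not_less_Least[of j "\<lambda>i. i \<in> I \<and> x i \<noteq> y i"] unfolding i_def by blast
  ultimately show ?thesis
    unfolding lex_less_def by (metis linorder_neqE_linordered_idom)
qed

lemma continuous_on_apply [continuous_intros]:
  "continuous_on S (\<lambda>x. x i :: 'b::topological_space)"
  by (rule continuous_on_subset[OF continuous_on_product_coordinates]) simp

text \<open>Coordinates are maximized one after another in increasing order of index; each
  maximization leaves a nonempty compact slice for the next.\<close>

lemma lex_maximal_exists: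
  fixes C :: "(nat \<Rightarrow> real) set"
  assumes "finite I" "compact C" "C \<noteq> {}"
  shows "\<exists>x\<in>C. \<forall>y\<in>C. \<not> lex_less I x y"
  using assms
proof (induction I rule: finite_linorder_max_induct)
  case empty
  then show ?case by (auto simp: lex_less_def)
next
  case (insert b A)
  obtain x where x: "x \<in> C" "\<And>y. y \<in> C \<Longrightarrow> \<not> lex_less A x y"
    using insert by blast
  \<comment> \<open>The slice of points that agree with \<open>x\<close> at all earlier indices;
    coordinate \<open>b\<close> is then maximized on it.\<close>
  define C' where "C' = C \<inter> (\<Inter>j\<in>A. {y. y j = x j})"
  have "closed (\<Inter>j\<in>A. {y. y j = x j})"
    by (intro closed_INT ballI closed_Collect_eq continuous_intros)
  then have "compact C'"
    unfolding C'_def by (rule compact_Int_closed[OF insert.prems(1)])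
  moreover have "C' \<noteq> {}"
    using x by (auto simp: C'_def)
  ultimately obtain z where z: "z \<in> C'" "\<And>y. y \<in> C' \<Longrightarrow> y b \<le> z b"
    using continuous_attains_sup[of C' "\<lambda>y. y b"] continuous_on_apply by metis
  have zx: "z j = x j" if "j \<in> A" for j
    using z(1) that by (auto simp: C'_def)
  have "\<not> lex_less (insert b A) z y" if y: "y \<in> C" for y
  proof
    assume "lex_less (insert b A) z y"
    then obtain i where i: "i \<in> insert b A" "z i < y i"
      "\<And>j. j \<in> insert b A \<Longrightarrow> j < i \<Longrightarrow> z j = y j"
      unfolding lex_less_def by blast
    show False
    proof (cases "i \<in> A")
      case True
      \<comment> \<open>Since \<open>z\<close> agrees with \<open>x\<close> on \<open>A\<close>, the
        point \<open>y\<close> would improve \<open>x\<close> as well.\<close>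
      then have "lex_less A x y"
        unfolding lex_less_def
      proof (intro bexI conjI ballI impI)
        show "x i < y i" using i(2) zx[OF True] by simp
        show "x j = y j" if "j \<in> A" "j < i" for j
          using i(3)[of j] zx[of j] that by simp
      qed
      with x y show False by blast
    next
      case False
      then have "i = b" using i by auto
      \<comment> \<open>The first difference is at the last index, so \<open>y\<close> lies in the
        slice on which \<open>z b\<close> is maximal.\<close>
      then have "y \<in> C'"
        unfolding C'_def using y i(3) zx insert.hyps by auto
      with z i \<open>i = b\<close> show False by force
    qed
  qed
  with z show ?case by (auto simp: C'_def)
qed

section \<open>Geometric realizations and spheres\<close>

lemma geom_realization_eq: "geom_realization K = top_of_set (geom_carrier K)"
  by (simp add: geom_realization_def euclidean_product_topology)

text \<open>Summing over the fixed set \<open>I\<close> instead of the varying support makes the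
  condition linear and continuous in \<open>x\<close>.\<close>

lemma geom_carrier_iff:
  assumes "finite I" "K \<subseteq> Pow I"
  shows "x \<in> geom_carrier K \<longleftrightarrow> (\<forall>v. 0 \<le> x v) \<and> {v. x v \<noteq> 0} \<in> K \<and> (\<Sum>v\<in>I. x v) = 1"
proof -
  have "(\<Sum>v\<in>{v. x v \<noteq> 0}. x v) = (\<Sum>v\<in>I. x v)" if "{v. x v \<noteq> 0} \<in> K"
    using that assms by (intro sum.mono_neutral_left) auto
  then show ?thesis
    by (auto simp: geom_carrier_def)
qed

text \<open>A product of unit intervals is compact by Tychonoff, and closed conditions cut the
  simplex out of it, including the vanishing of the infinitely many coordinates outside
  \<open>I\<close>.\<close>

lemma compact_geom_simplex:
  fixes I :: "nat set"
  assumes "finite I"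
  shows "compact (geom_carrier (Pow I))"
proof -
  have eq: "geom_carrier (Pow I) = PiE UNIV (\<lambda>_. {0..1}) \<inter>
     ((\<Inter>v\<in>-I. {x. x v = 0}) \<inter> {x. (\<Sum>v\<in>I. x v) = 1})"
  proof (intro set_eqI iffI)
    fix x assume "x \<in> geom_carrier (Pow I)"
    then have x: "\<forall>v. 0 \<le> x v" "{v. x v \<noteq> 0} \<subseteq> I" "(\<Sum>v\<in>I. x v) = 1"
      using geom_carrier_iff[OF assms, of "Pow I" x] by auto
    have "x v \<le> 1" for v
    proof (cases "v \<in> I")
      case True
      then show ?thesis using x member_le_sum[of v I x] assms by auto
    next
      case False
      then have "x v = 0" using x(2) by auto
      then show ?thesis by simp
    qed
    with x show "x \<in> PiE UNIV (\<lambda>_. {0..1}) \<inter>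
     ((\<Inter>v\<in>-I. {x. x v = 0}) \<inter> {x. (\<Sum>v\<in>I. x v) = 1})"
      by auto
  next
    fix x :: "nat \<Rightarrow> real"
    assume "x \<in> PiE UNIV (\<lambda>_. {0..1}) \<inter>
     ((\<Inter>v\<in>-I. {x. x v = 0}) \<inter> {x. (\<Sum>v\<in>I. x v) = 1})"
    then show "x \<in> geom_carrier (Pow I)"
      using geom_carrier_iff[OF assms, of "Pow I" x] by (fastforce simp: PiE_iff)
  qed
  have "compactin (powertop_real UNIV) (PiE UNIV (\<lambda>_::nat. {0..1::real}))"
    by (simp add: compactin_PiE)
  then have "compact (PiE UNIV (\<lambda>_::nat. {0..1::real}))"
    by (simp add: euclidean_product_topology)
  moreover have "closed ((\<Inter>v\<in>-I. {x. x v = 0}) \<inter> {x::nat \<Rightarrow> real. (\<Sum>v\<in>I. x v) = 1})"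
    by (intro closed_Int closed_INT ballI closed_Collect_eq continuous_intros)
  ultimately show ?thesis
    unfolding eq by (rule compact_Int_closed)
qed

lemma compact_geom_carrier:
  fixes K :: "nat set set"
  assumes "abs_complex K"
  shows "compact (geom_carrier K)"
proof -
  \<comment> \<open>A finite union of closed simplices.\<close>
  have "geom_carrier K = (\<Union>\<tau>\<in>K. geom_carrier (Pow \<tau>))"
    using assms unfolding geom_carrier_def abs_complex_def by auto
  then show ?thesis
    using assms by (auto simp: abs_complex_def intro!: compact_UN compact_geom_simplex)
qed

lemma homeomorphic_imp_homeomorphic_space:
  assumes "S homeomorphic T"
  shows "top_of_set S homeomorphic_space top_of_set T"
proof -
  obtain f g where "homeomorphism S T f g"
    using assms by (auto simp: homeomorphic_def)
  then have "homeomorphic_maps (top_of_set S) (top_of_set T) f g"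
    unfolding homeomorphism_def homeomorphic_maps_def
    by (auto simp: continuous_map_in_subtopology)
  then show ?thesis by (auto simp: homeomorphic_space_def)
qed

text \<open>Coordinates in an orthonormal basis of \<open>V\<close> identify its unit sphere with
  \<open>nsphere\<close>. If \<open>V\<close> is zero, it has no unit vector and both sides are
  empty.\<close>

lemma sphere_Int_subspace_homeomorphic_sphere_space:
  fixes V :: "'a::euclidean_space set"
  assumes "subspace V"
  shows "top_of_set (sphere 0 1 \<inter> V) homeomorphic_space sphere_space (int (dim V) - 1)"
proof (cases "dim V = 0")
  case True
  then have "V \<subseteq> {0}" by simp
  then have "sphere 0 1 \<inter> V = {}" by auto
  then show ?thesis
    using True by (simp add: sphere_space_def homeomorphic_empty_space_eq)
next
  case False
  define d where "d = dim V"
  obtain B where B: "B \<subseteq> V" "pairwise orthogonal B" "\<And>x. x \<in> B \<Longrightarrow> norm x = 1"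
    "independent B" "card B = d" "span B = V"
    using orthonormal_basis_subspace[OF assms] d_def by metis
  have "finite B" using B(4) independent_imp_finite by blast
  then obtain e where e: "bij_betw e {..<d} B"
    using ex_bij_betw_nat_finite[of B] B(5) by (auto simp: atLeast0LessThan)
  have e_inner: "e i \<bullet> e j = (if i = j then 1 else 0)" if "i < d" "j < d" for i j
  proof (cases "i = j")
    case True
    then show ?thesis using that B(3)[of "e i"] e by (auto simp: bij_betw_def norm_eq_1)
  next
    case False
    then have "e i \<noteq> e j" using that e by (auto simp: bij_betw_def inj_on_def)
    then show ?thesis
      using B(2) that e False by (auto simp: bij_betw_def pairwise_def orthogonal_def)
  qed
  define f where "f = (\<lambda>y k. if k < d then y \<bullet> e k else 0 :: real)"
  define g where "g = (\<lambda>x::nat \<Rightarrow> real. \<Sum>k<d. x k *\<^sub>R e k)"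
  define T where "T = {x::nat \<Rightarrow> real. (\<forall>i\<ge>d. x i = 0) \<and> (\<Sum>i<d. (x i)\<^sup>2) = 1}"
  have g_inner: "g x \<bullet> e j = x j" if "j < d" for x j
    using that by (simp add: g_def inner_sum_left e_inner if_distrib cong: if_cong)
  have fg: "f (g x) = x" if "x \<in> T" for x
    using that by (auto simp: f_def g_inner T_def)
  have gV: "g x \<in> V" for x
    unfolding g_def using B(1) e
    by (intro subspace_sum subspace_scale assms) (auto simp: bij_betw_def)
  have gf: "g (f y) = y" if "y \<in> V" for y
  proof -
    \<comment> \<open>The difference lies in the span of \<open>B\<close> and is orthogonal to it,
      hence to itself.\<close>
    have "(y - g (f y)) \<bullet> b = 0" if b: "b \<in> B" for b
    proof -
      obtain j where "j < d" "b = e j" using b e unfolding bij_betw_def by blast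
      then show ?thesis by (simp add: inner_diff_left g_inner f_def)
    qed
    moreover have "y - g (f y) \<in> span B"
      using that gV B(6) assms by (simp add: subspace_diff)
    ultimately have "y - g (f y) = 0"
      using orthogonal_to_span[of "y - g (f y)" B "y - g (f y)"]
      by (simp add: orthogonal_def)
    then show ?thesis by simp
  qed
  have norm_g: "(norm (g x))\<^sup>2 = (\<Sum>i<d. (x i)\<^sup>2)" for x
  proof -
    have "(norm (g x))\<^sup>2 = (\<Sum>i<d. x i * (g x \<bullet> e i))"
      unfolding power2_norm_eq_inner by (subst (2) g_def) (simp add: inner_sum_right)
    then show ?thesis by (simp add: g_inner power2_eq_square)
  qed
  have "homeomorphism (sphere 0 1 \<inter> V) T f g"
    unfolding homeomorphism_def
  proof (intro conjI ballI)
    show "continuous_on (sphere 0 1 \<inter> V) f"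
      unfolding f_def
    proof (rule continuous_on_coordinatewise_then_product)
      show "continuous_on (sphere 0 1 \<inter> V) (\<lambda>y. if k < d then y \<bullet> e k else 0)" for k
        by (cases "k < d") (auto intro!: continuous_intros)
    qed
    show "continuous_on T g"
      unfolding g_def by (intro continuous_intros)
    have fT: "f y \<in> T" if "y \<in> sphere 0 1 \<inter> V" for y
      using norm_g[of "f y"] gf[of y] that by (auto simp: T_def f_def)
    have gS: "g x \<in> sphere 0 1 \<inter> V" if "x \<in> T" for x
      using norm_g[of x] gV that power2_eq_imp_eq[of "norm (g x)" 1] by (simp add: T_def)
    show "f ` (sphere 0 1 \<inter> V) = T"
    proof (intro equalityI image_subsetI fT)
      show "T \<subseteq> f ` (sphere 0 1 \<inter> V)" using fg gS by (metis image_eqI subsetI)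
    qed
    show "g ` T = sphere 0 1 \<inter> V"
    proof (intro equalityI image_subsetI gS)
      show "sphere 0 1 \<inter> V \<subseteq> g ` T" using gf fT by (metis IntD2 image_eqI subsetI)
    qed
  qed (use gf fg in auto)
  then have "top_of_set (sphere 0 1 \<inter> V) homeomorphic_space top_of_set T"
    using homeomorphic_def homeomorphic_imp_homeomorphic_space by blast
  moreover have "sphere_space (int (dim V) - 1) = top_of_set T"
  proof -
    \<comment> \<open>\<open>nsphere k\<close> uses the \<open>k + 1\<close> coordinates
      \<open>0, ..., k\<close>, so the sphere of dimension \<open>d - 1\<close> uses exactly those
      below \<open>d\<close>.\<close>
    have d: "Suc (nat (int (dim V) - 1)) = d" using False unfolding d_def by linarith
    then have "{..nat (int (dim V) - 1)} = {..<d}"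
      by (metis lessThan_Suc_atMost)
    with d show ?thesis
      using False unfolding sphere_space_def nsphere_def Euclidean_space_def T_def
      by (simp add: subtopology_subtopology euclidean_product_topology Int_def conj_commute d_def)
  qed
  ultimately show ?thesis by simp
qed

section \<open>The nerve of the boundary of a polytope\<close>

text \<open>
  The \<open>w i\<close> are the points whose convex hull is the polar dual of the polytope \<open>D\<close>; they need
  be neither distinct nor vertices of the dual. Then \<open>nerve\<close> is the nerve of the cover of the
  relative boundary of \<open>D\<close> by its faces \<open>{z \<in> D. w i \<bullet> z = 1}\<close>, and \<open>polar_boundary\<close> is the
  relative boundary of the polar dual.
\<close>

locale polar_points =
  fixes V :: "'a::euclidean_space set" and I :: "nat set" and w :: "nat \<Rightarrow> 'a"
    and D :: "'a set"
  assumes subspace_V: "subspace V" and finite_I: "finite I"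
    and w_in: "i \<in> I \<Longrightarrow> w i \<in> V"
    and D_eq: "D = {z \<in> V. \<forall>i\<in>I. w i \<bullet> z \<le> 1}"
    and bounded_D: "bounded D"
begin

definition nerve :: "nat set set" where
  "nerve = {\<tau>. \<tau> \<subseteq> I \<and> (\<exists>z\<in>D. \<forall>i\<in>\<tau>. w i \<bullet> z = 1)}"

definition polar_boundary :: "'a set" where
  "polar_boundary = {y \<in> V. (\<forall>z\<in>D. y \<bullet> z \<le> 1) \<and> (\<exists>z\<in>D. y \<bullet> z = 1)}"

abbreviation \<Delta> :: "(nat \<Rightarrow> real) set" where
  "\<Delta> \<equiv> geom_carrier (Pow I)"

definition \<phi> :: "(nat \<Rightarrow> real) \<Rightarrow> 'a" where
  "\<phi> x = (\<Sum>i\<in>I. x i *\<^sub>R w i)"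

definition lex_max :: "(nat \<Rightarrow> real) \<Rightarrow> bool" where
  "lex_max x \<longleftrightarrow> x \<in> \<Delta> \<and> (\<forall>y\<in>\<Delta>. \<phi> y = \<phi> x \<longrightarrow> \<not> lex_less I x y)"

text \<open>The subcomplex \<open>Z\<close> of the overview. Quantifying over all points of the
  closed simplex makes closure under subsets immediate.\<close>

definition core :: "nat set set" where
  "core = {\<tau> \<in> nerve. \<forall>x\<in>\<Delta>. {i. x i \<noteq> 0} \<subseteq> \<tau> \<longrightarrow> lex_max x}"

section \<open>The simplex over \<open>I\<close> and the values of \<open>\<phi>\<close> on
  \<open>D\<close>\<close>

lemma simplex_iff: "x \<in> \<Delta> \<longleftrightarrow> (\<forall>v. 0 \<le> x v) \<and> {v. x v \<noteq> 0} \<subseteq> I \<and> (\<Sum>v\<in>I. x v) = 1"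
  using geom_carrier_iff[OF finite_I, of "Pow I"] by auto

lemma simplex_support_ne: "{v. x v \<noteq> 0} \<noteq> {}" if "x \<in> \<Delta>"
proof
  assume "{v. x v \<noteq> 0} = {}"
  then have "(\<Sum>v\<in>I. x v) = 0" by simp
  with that show False by (simp add: simplex_iff)
qed

lemma simplex_zero: "x i = 0" if "x \<in> \<Delta>" "i \<notin> I"
  using that by (auto simp: simplex_iff)

lemma simplex_le_1: "x i \<le> 1" if "x \<in> \<Delta>"
  using that member_le_sum[of i I x] finite_I simplex_zero[of x i]
  by (cases "i \<in> I") (simp_all add: simplex_iff)

lemma simplex_convex:
  assumes "x \<in> \<Delta>" "y \<in> \<Delta>" "0 \<le> s" "0 \<le> t" "s + t = 1"
  shows "(\<lambda>i. s * x i + t * y i) \<in> \<Delta>"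
proof -
  have "s * x i + t * y i = 0" if "i \<notin> I" for i
    using simplex_zero[OF assms(1) that] simplex_zero[OF assms(2) that] by simp
  then have "{i. s * x i + t * y i \<noteq> 0} \<subseteq> I" by blast
  then show ?thesis
    using assms by (simp add: simplex_iff sum.distrib flip: sum_distrib_left)
qed

lemma zero_in_D: "0 \<in> D"
  using subspace_V by (auto simp: D_eq subspace_0)

lemma abs_complex_nerve: "abs_complex nerve"
proof -
  have "finite nerve"
    by (rule finite_subset[of _ "Pow I"]) (use finite_I in \<open>auto simp: nerve_def\<close>)
  then show ?thesis
    using zero_in_D finite_I unfolding abs_complex_def nerve_def
    by (auto intro: finite_subset)
qed

lemma carrier_nerve_subset: "geom_carrier nerve \<subseteq> \<Delta>"
  by (auto simp: geom_carrier_def nerve_def)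

lemma core_subset: "core \<subseteq> nerve"
  by (auto simp: core_def)

lemma abs_complex_core: "abs_complex core"
proof -
  \<comment> \<open>No point of the simplex has empty support, so the empty simplex belongs to the
    core vacuously.\<close>
  have "\<not> {i. x i \<noteq> 0} \<subseteq> {}" if "x \<in> \<Delta>" for x :: "nat \<Rightarrow> real"
    using simplex_support_ne[OF that] by simp
  then have "{} \<in> core"
    using abs_complex_nerve by (auto simp: core_def abs_complex_def)
  moreover have "\<tau> \<in> core" if "\<sigma> \<in> core" "\<tau> \<subseteq> \<sigma>" for \<sigma> \<tau>
    using that abs_complex_nerve unfolding core_def abs_complex_def by blast
  ultimately show ?thesis
    using abs_complex_nerve core_subset finite_subset unfolding abs_complex_def by (metis subsetD)
qed

lemma inner_\<phi>: "\<phi> x \<bullet> z = (\<Sum>i\<in>I. x i * (w i \<bullet> z))"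
  by (simp add: \<phi>_def inner_sum_left)

lemma \<phi>_le_1:
  assumes "x \<in> \<Delta>" "z \<in> D"
  shows "\<phi> x \<bullet> z \<le> 1"
proof -
  have "\<phi> x \<bullet> z \<le> (\<Sum>i\<in>I. x i * 1)"
    unfolding inner_\<phi> using assms
    by (intro sum_mono mult_left_mono) (auto simp: simplex_iff D_eq)
  then show ?thesis using assms by (simp add: simplex_iff)
qed

text \<open>\<open>1 - \<phi> x \<bullet> z\<close> is a nonnegative combination of the slacks
  \<open>1 - w i \<bullet> z\<close>, so it vanishes exactly when every slack with positive weight
  does.\<close>

lemma \<phi>_eq_1_iff:
  assumes "x \<in> \<Delta>" "z \<in> D"
  shows "\<phi> x \<bullet> z = 1 \<longleftrightarrow> (\<forall>i. x i \<noteq> 0 \<longrightarrow> w i \<bullet> z = 1)"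
proof -
  have "1 - \<phi> x \<bullet> z = (\<Sum>i\<in>I. x i * (1 - w i \<bullet> z))"
    using assms by (simp add: inner_\<phi> simplex_iff algebra_simps sum_subtractf)
  moreover have "(\<Sum>i\<in>I. x i * (1 - w i \<bullet> z)) = 0 \<longleftrightarrow> (\<forall>i\<in>I. x i * (1 - w i \<bullet> z) = 0)"
    using assms by (intro sum_nonneg_eq_0_iff finite_I) (auto simp: simplex_iff D_eq)
  ultimately show ?thesis
    using assms by (auto simp: simplex_iff)
qed

lemma \<phi>_in_V: "\<phi> x \<in> V"
  unfolding \<phi>_def by (intro subspace_sum subspace_scale subspace_V w_in)

text \<open>A point \<open>z\<close> of \<open>D\<close> lies on all faces indexed by the support of
  \<open>x\<close> iff \<open>\<phi> x \<bullet> z = 1\<close>. Hence the nerve consists of whole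
  fibres of \<open>\<phi>\<close>, which is what keeps the later homotopy inside it.\<close>

lemma carrier_nerve_iff: "x \<in> geom_carrier nerve \<longleftrightarrow> x \<in> \<Delta> \<and> \<phi> x \<in> polar_boundary"
proof -
  have "x \<in> geom_carrier nerve \<longleftrightarrow> x \<in> \<Delta> \<and> (\<exists>z\<in>D. \<forall>i. x i \<noteq> 0 \<longrightarrow> w i \<bullet> z = 1)"
    by (auto simp: geom_carrier_def nerve_def)
  then show ?thesis
    using \<phi>_eq_1_iff \<phi>_le_1 \<phi>_in_V by (auto simp: polar_boundary_def)
qed

section \<open>Lexicographic maxima in the fibres of \<open>\<phi>\<close>\<close>

lemma \<phi>_add_scaled: "\<phi> (\<lambda>i. x i + t * (y i - z i)) = \<phi> x + t *\<^sub>R (\<phi> y - \<phi> z)"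
  by (simp add: \<phi>_def algebra_simps sum.distrib sum_subtractf scaleR_sum_right)

text \<open>
  If \<open>y\<close> could be improved to \<open>y'\<close>, then moving \<open>x\<close> slightly in the direction \<open>y' - y\<close>
  would improve \<open>x\<close>.
\<close>
lemma lex_max_support_mono:
  assumes x: "lex_max x" and y: "y \<in> \<Delta>" "{i. y i \<noteq> 0} \<subseteq> {i. x i \<noteq> 0}"
  shows "lex_max y"
  unfolding lex_max_def
proof (intro conjI ballI impI notI y(1))
  fix y' assume y': "y' \<in> \<Delta>" "\<phi> y' = \<phi> y" "lex_less I y y'"
  have x\<Delta>: "x \<in> \<Delta>" using x by (simp add: lex_max_def)
  define S where "S = {i. x i \<noteq> 0}"
  have S: "finite S" "S \<noteq> {}"
    using x\<Delta> finite_I simplex_support_ne[OF x\<Delta>]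
    by (auto simp: simplex_iff S_def intro: finite_subset)
  \<comment> \<open>The smallest positive coordinate of \<open>x\<close>. As
    \<open>y i \<le> 1\<close> and \<open>0 \<le> y' i\<close>, moving \<open>x\<close> by
    \<open>t\<close> times \<open>y' - y\<close> lowers a coordinate by at most \<open>t\<close>, so
    none becomes negative.\<close>
  define t where "t = Min (x ` S)"
  have t: "t > 0" "\<And>i. i \<in> S \<Longrightarrow> t \<le> x i"
  proof -
    have "x i > 0" if "i \<in> S" for i
      using that x\<Delta> by (simp add: S_def simplex_iff less_le)
    then show "t > 0" using S by (simp add: t_def)
    show "t \<le> x i" if "i \<in> S" for i
      using that S by (simp add: t_def)
  qed
  have y1: "y i \<le> 1" for i
    using simplex_le_1[OF y(1)] .
  define x' where "x' = (\<lambda>i. x i + t * (y' i - y i))"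
  have "0 \<le> x' i" for i
  proof (cases "i \<in> S")
    case True
    have "t * (y i - y' i) \<le> t * 1"
      using y1[of i] y'(1) t(1) by (intro mult_left_mono) (auto simp: simplex_iff intro: order_trans[of _ "y i"])
    then show ?thesis using t(2)[OF True] by (simp add: x'_def algebra_simps)
  next
    case False
    then have "x i = 0" "y i = 0" using y(2) by (auto simp: S_def)
    then show ?thesis using y'(1) t(1) by (simp add: x'_def simplex_iff)
  qed
  moreover have "x' i = 0" if "i \<notin> I" for i
    using that x\<Delta> y(1) y'(1) by (simp add: x'_def simplex_zero)
  then have "{i. x' i \<noteq> 0} \<subseteq> I" by blast
  moreover have "(\<Sum>i\<in>I. x' i) = 1"
    using x\<Delta> y y' by (simp add: simplex_iff x'_def sum.distrib sum_subtractf flip: sum_distrib_left)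
  ultimately have "x' \<in> \<Delta>" unfolding simplex_iff by blast
  moreover have "\<phi> x' = \<phi> x"
    unfolding x'_def \<phi>_add_scaled using y' by simp
  moreover have "lex_less I x x'"
  proof -
    obtain i where "i \<in> I" "y i < y' i" "\<forall>j\<in>I. j < i \<longrightarrow> y j = y' j"
      using y'(3) by (auto simp: lex_less_def)
    with t(1) show ?thesis
      unfolding lex_less_def x'_def by (intro bexI[of _ i]) auto
  qed
  ultimately show False using x by (auto simp: lex_max_def)
qed

text \<open>One maximal point suffices: by \<open>lex_max_support_mono\<close> all points of the
  closed simplex on its support are maximal, so this support belongs to the core.\<close>

lemma carrier_core: "geom_carrier core = {x \<in> geom_carrier nerve. lex_max x}"
proof (intro set_eqI iffI)
  fix x assume x: "x \<in> geom_carrier core"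
  then show "x \<in> {x \<in> geom_carrier nerve. lex_max x}"
    using carrier_nerve_subset by (auto simp: core_def geom_carrier_def)
next
  fix x assume "x \<in> {x \<in> geom_carrier nerve. lex_max x}"
  then show "x \<in> geom_carrier core"
    using lex_max_support_mono by (auto simp: core_def geom_carrier_def)
qed

text \<open>Distinct points of the simplex differ at some index in \<open>I\<close>, so one of them
  is lexicographically smaller.\<close>

lemma lex_max_unique:
  assumes "lex_max x" "lex_max y" "\<phi> x = \<phi> y"
  shows "x = y"
proof (rule ccontr)
  assume "x \<noteq> y"
  then obtain i where i: "x i \<noteq> y i" by auto
  then have "i \<in> I" using assms simplex_zero[of x i] simplex_zero[of y i]
    unfolding lex_max_def by argo
  with i lex_less_total[OF finite_I, of x y] assms show False
    by (auto simp: lex_max_def)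
qed

lemma inj_on_\<phi>_core: "inj_on \<phi> (geom_carrier core)"
  by (intro inj_onI lex_max_unique) (auto simp: carrier_core)

section \<open>The homeomorphism from the core onto the polar boundary\<close>

lemma continuous_on_\<phi>: "continuous_on S \<phi>"
  unfolding \<phi>_def by (intro continuous_intros)

text \<open>
  A point of the polar boundary outside the convex hull of the \<open>w i\<close> would be separated from it
  by some \<open>z \<in> V\<close>; a positive multiple of \<open>z\<close> then lies in \<open>D\<close>, or \<open>D\<close> is unbounded.
\<close>
lemma polar_boundary_subset: "polar_boundary \<subseteq> \<phi> ` \<Delta>"
proof
  fix y assume y: "y \<in> polar_boundary"
  show "y \<in> \<phi> ` \<Delta>"
  proof (rule ccontr)
    assume ny: "y \<notin> \<phi> ` \<Delta>"
    have "compact (\<phi> ` \<Delta>)"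
      by (intro compact_continuous_image continuous_on_\<phi> compact_geom_simplex finite_I)
    moreover have "convex (\<phi> ` \<Delta>)"
    proof (rule convexI)
      fix a b and u v :: real
      assume uv: "0 \<le> u" "0 \<le> v" "u + v = 1" and "a \<in> \<phi> ` \<Delta>" "b \<in> \<phi> ` \<Delta>"
      then obtain p q where p: "p \<in> \<Delta>" "a = \<phi> p" and q: "q \<in> \<Delta>" "b = \<phi> q" by auto
      have "(\<lambda>i. u * p i + v * q i) \<in> \<Delta>"
        by (intro simplex_convex p q uv)
      moreover have "u *\<^sub>R a + v *\<^sub>R b = \<phi> (\<lambda>i. u * p i + v * q i)"
        using p q by (simp add: \<phi>_def scaleR_sum_right sum.distrib algebra_simps)
      ultimately show "u *\<^sub>R a + v *\<^sub>R b \<in> \<phi> ` \<Delta>" by (rule rev_image_eqI[where f = \<phi>])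
    qed
    ultimately obtain a b where ab: "a \<bullet> y < b" "\<And>x. x \<in> \<phi> ` \<Delta> \<Longrightarrow> a \<bullet> x > b"
      using separating_hyperplane_closed_point[of "\<phi> ` \<Delta>" y] ny compact_imp_closed by metis
    \<comment> \<open>The separating normal is projected to \<open>V\<close>; this does not change
      its inner products with \<open>y\<close> and the \<open>w i\<close>.\<close>
    obtain z1 z2 where z: "z1 \<in> V" "\<And>v. v \<in> V \<Longrightarrow> orthogonal z2 v" "a = z1 + z2"
      using orthogonal_subspace_decomp_exists[of V a] subspace_V by (metis span_eq_iff)
    have az: "a \<bullet> v = z1 \<bullet> v" if "v \<in> V" for v
      using z(2)[OF that] z(3) by (simp add: orthogonal_def inner_add_left)
    \<comment> \<open>The sign is reversed so that \<open>z\<close> takes a larger value on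
      \<open>y\<close> than on every \<open>w i\<close>, with \<open>- b\<close> strictly in
      between.\<close>
    define z where "z = - z1"
    have zV: "z \<in> V" using z(1) subspace_V by (simp add: z_def subspace_neg)
    have zy: "y \<bullet> z > - b"
      using ab(1) az[of y] y by (simp add: z_def polar_boundary_def inner_commute)
    have zw: "w i \<bullet> z < - b" if i: "i \<in> I" for i
    proof -
      define e where "e = (\<lambda>j. if j = i then 1 else 0 :: real)"
      have "e \<in> \<Delta>"
        using i finite_I by (auto simp: simplex_iff e_def)
      moreover have "\<phi> e = w i"
        using i finite_I by (simp add: \<phi>_def e_def if_distrib[of "\<lambda>c. c *\<^sub>R _"] cong: if_cong)
      ultimately have "a \<bullet> w i > b" using ab(2) by (metis imageI)
      then show ?thesis
        using az[OF w_in[OF i]] by (simp add: z_def inner_commute)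
    qed
    show False
    proof (cases "b < 0")
      case True
      then have c: "0 < - b" by simp
      \<comment> \<open>Scaling the threshold \<open>- b\<close> to 1 puts \<open>z\<close> into
        \<open>D\<close>, while \<open>y\<close> exceeds 1 there.\<close>
      have "w i \<bullet> ((1 / - b) *\<^sub>R z) \<le> 1" if "i \<in> I" for i
        unfolding inner_scaleR_right using zw[OF that] c pos_divide_le_eq[OF c, of "w i \<bullet> z" 1] by simp
      then have "(1 / - b) *\<^sub>R z \<in> D"
        unfolding D_eq using zV subspace_V subspace_scale by blast
      then have "y \<bullet> ((1 / - b) *\<^sub>R z) \<le> 1"
        using y unfolding polar_boundary_def by blast
      then show False
        unfolding inner_scaleR_right using zy pos_divide_le_eq[OF c, of "y \<bullet> z" 1] by simp
    next
      case False
      \<comment> \<open>All \<open>w i\<close> are negative on \<open>z\<close>, so \<open>D\<close>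
        contains the whole ray through \<open>z\<close>.\<close>
      have D: "t *\<^sub>R z \<in> D" if "t \<ge> 0" for t :: real
      proof -
        have "t * (w i \<bullet> z) \<le> 1" if "i \<in> I" for i
          using zw[OF that] False \<open>t \<ge> 0\<close> mult_nonneg_nonpos[of t "w i \<bullet> z"] by linarith
        then show ?thesis using zV subspace_V by (simp add: D_eq subspace_scale)
      qed
      obtain B where B: "\<And>x. x \<in> D \<Longrightarrow> norm x \<le> B" using bounded_D bounded_iff by blast
      have "z \<noteq> 0"
      proof
        assume "z = 0"
        \<comment> \<open>At \<open>z = 0\<close> the two strict bounds contradict each other unless
          there is no index at all. Then \<open>D\<close> is the subspace \<open>V\<close>, and
          doubling a point where \<open>y\<close> takes the value 1 violates the bound by 1.\<close>
        then have "I = {}" using zy zw by force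
        then have "D = V" by (auto simp: D_eq)
        moreover obtain z where "z \<in> D" "y \<bullet> z = 1" using y by (auto simp: polar_boundary_def)
        ultimately have "2 *\<^sub>R z \<in> D" using subspace_V by (simp add: subspace_scale)
        then have "y \<bullet> (2 *\<^sub>R z) \<le> 1" using y unfolding polar_boundary_def by blast
        then show False using \<open>y \<bullet> z = 1\<close> by simp
      qed
      \<comment> \<open>The factor gives the vector norm \<open>\<bar>B\<bar> + 1\<close>, which
        exceeds the bound \<open>B\<close>.\<close>
      have "norm (((\<bar>B\<bar> + 1) / norm z) *\<^sub>R z) \<le> B" by (intro B D) auto
      then show False using \<open>z \<noteq> 0\<close> by simp
    qed
  qed
qed

text \<open>The fibre over a point of the polar boundary is nonempty and compact, so it has a
  lexicographic maximum, which lies in the nerve because its image lies in the boundary.\<close>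

lemma \<phi>_image_core: "\<phi> ` geom_carrier core = polar_boundary"
proof
  show "\<phi> ` geom_carrier core \<subseteq> polar_boundary"
    by (auto simp: carrier_core carrier_nerve_iff)
  show "polar_boundary \<subseteq> \<phi> ` geom_carrier core"
  proof
    fix y assume y: "y \<in> polar_boundary"
    define C where "C = \<Delta> \<inter> {x. \<phi> x = y}"
    have "compact C"
      unfolding C_def
      by (intro compact_Int_closed compact_geom_simplex finite_I closed_Collect_eq continuous_on_\<phi> continuous_intros)
    moreover have "C \<noteq> {}" using polar_boundary_subset y by (auto simp: C_def)
    ultimately obtain x where "x \<in> C" "\<And>x'. x' \<in> C \<Longrightarrow> \<not> lex_less I x x'"
      using lex_maximal_exists[OF finite_I] by metis
    then have "lex_max x" "\<phi> x = y" by (auto simp: C_def lex_max_def)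
    then show "y \<in> \<phi> ` geom_carrier core"
      using y by (auto simp: carrier_core carrier_nerve_iff lex_max_def)
  qed
qed

text \<open>A continuous injection of a compact space into a Hausdorff space is a homeomorphism onto
  its image.\<close>

lemma core_homeomorphism:
  obtains \<psi> where "homeomorphism (geom_carrier core) polar_boundary \<phi> \<psi>"
  using homeomorphism_compact[OF compact_geom_carrier[OF abs_complex_core] continuous_on_\<phi>
      \<phi>_image_core inj_on_\<phi>_core] by blast

section \<open>The deformation of the nerve onto the core\<close>

lemma core_deformation_retract:
  "geom_carrier core strong_deformation_retract_of geom_realization nerve"
proof -
  obtain \<psi> where \<psi>: "homeomorphism (geom_carrier core) polar_boundary \<phi> \<psi>"
    by (rule core_homeomorphism)
  \<comment> \<open>\<open>r x\<close> is the lexicographically maximal point in the fibre of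
    \<open>x\<close>.\<close>
  define r where "r = \<psi> \<circ> \<phi>"
  let ?N = "geom_carrier nerve"
  have \<phi>N: "\<phi> x \<in> polar_boundary" if "x \<in> ?N" for x
    using that carrier_nerve_iff by blast
  have rN: "r x \<in> geom_carrier core" "\<phi> (r x) = \<phi> x" if "x \<in> ?N" for x
    using \<psi> \<phi>N[OF that] unfolding r_def homeomorphism_def by auto
  have core_N: "geom_carrier core \<subseteq> ?N"
    by (auto simp: carrier_core)
  have r_id: "r x = x" if "x \<in> geom_carrier core" for x
    using \<psi> that unfolding r_def homeomorphism_def by auto
  have cont_r: "continuous_on ?N r"
    unfolding r_def
    by (intro continuous_on_compose continuous_on_\<phi>
        continuous_on_subset[OF homeomorphism_cont2[OF \<psi>]]) (use \<phi>N in auto)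
  define h where "h = (\<lambda>(t::real, x::nat \<Rightarrow> real). (\<lambda>i. (1 - t) * x i + t * r x i))"
  have cont_h: "continuous_on ({0..1} \<times> ?N) h"
  proof (rule continuous_on_coordinatewise_then_product)
    fix i
    have x: "continuous_on ({0..1} \<times> ?N) (\<lambda>p. snd p i)"
      by (rule continuous_on_compose2[where g = "\<lambda>x. x i" and t = UNIV, OF continuous_on_apply
            continuous_on_snd[OF continuous_on_id]]) simp
    have "continuous_on ({0..1} \<times> ?N) (\<lambda>p. r (snd p))"
      by (rule continuous_on_compose2[OF cont_r continuous_on_snd[OF continuous_on_id]]) auto
    then have r: "continuous_on ({0..1} \<times> ?N) (\<lambda>p. r (snd p) i)"
      using continuous_on_compose2[where g = "\<lambda>x. x i" and t = UNIV, OF continuous_on_apply]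
      by blast
    show "continuous_on ({0..1} \<times> ?N) (\<lambda>p. h p i)"
      unfolding h_def case_prod_beta by (intro continuous_intros x r)
  qed
  have h_N: "h (t, x) \<in> ?N" if t: "t \<in> {0..1}" and x: "x \<in> ?N" for t x
  proof -
    have x\<Delta>: "x \<in> \<Delta>" and r\<Delta>: "r x \<in> \<Delta>"
      using x rN[OF x] core_N carrier_nerve_subset by auto
    have "h (t, x) \<in> \<Delta>"
      using simplex_convex[OF x\<Delta> r\<Delta>, of "1 - t" t] t by (simp add: h_def)
    \<comment> \<open>Both ends of the segment have the same image, so \<open>\<phi>\<close> is
      constant along it and \<open>carrier_nerve_iff\<close> applies.\<close>
    moreover have "\<phi> (h (t, x)) = \<phi> x"
      using \<phi>_add_scaled[of x t "r x" x] rN(2)[OF x] by (simp add: h_def algebra_simps)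
    ultimately show ?thesis using \<phi>N[OF x] carrier_nerve_iff by metis
  qed
  have "homotopic_with (\<lambda>h. \<forall>x\<in>geom_carrier core. h x = x) (top_of_set ?N) (top_of_set ?N) id r"
    unfolding homotopic_with_def
  proof (intro exI[of _ h] conjI allI ballI)
    show "continuous_map (prod_topology (top_of_set {0..1}) (top_of_set ?N)) (top_of_set ?N) h"
      using cont_h h_N by (auto simp: continuous_map_in_subtopology)
  qed (auto simp: h_def r_id algebra_simps)
  then show ?thesis
    unfolding strong_deformation_retract_of_def geom_realization_eq
    using core_N rN by (intro conjI exI[of _ r]) auto
qed

section \<open>The polar boundary as a sphere\<close>

lemma compact_D: "compact D"
proof -
  have "D = V \<inter> (\<Inter>i\<in>I. {z. w i \<bullet> z \<le> 1})" by (auto simp: D_eq)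
  then have "closed D"
    using closed_subspace[OF subspace_V] by (auto intro!: closed_Int closed_INT closed_halfspace_le)
  with bounded_D show ?thesis by (simp add: compact_eq_bounded_closed)
qed

text \<open>Radial projection from 0: every ray from 0 in \<open>V\<close> meets the polar boundary
  exactly once.\<close>

lemma polar_boundary_homeomorphic_sphere: "polar_boundary homeomorphic (sphere 0 1 \<inter> V)"
proof -
  have nz: "y \<noteq> 0" if "y \<in> polar_boundary" for y
    using that by (auto simp: polar_boundary_def)
  show ?thesis
  proof (rule homeomorphic_compact[where f = "\<lambda>y. y /\<^sub>R norm y"])
    show "compact polar_boundary"
      unfolding \<phi>_image_core[symmetric]
      by (intro compact_continuous_image continuous_on_\<phi> compact_geom_carrier abs_complex_core)
    show "continuous_on polar_boundary (\<lambda>y. y /\<^sub>R norm y)"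
      using nz by (intro continuous_intros) auto
    show "inj_on (\<lambda>y. y /\<^sub>R norm y) polar_boundary"
    proof (rule inj_onI)
      fix x y assume xy: "x \<in> polar_boundary" "y \<in> polar_boundary" "x /\<^sub>R norm x = y /\<^sub>R norm y"
      \<comment> \<open>A \<open>z\<close> in \<open>D\<close> with \<open>x \<bullet> z = 1\<close>
        bounds \<open>y\<close> by 1, so on a common ray \<open>y\<close> lies no farther out than
        \<open>x\<close>.\<close>
      have le: "norm y \<le> norm x"
        if x: "x \<in> polar_boundary" and y: "y \<in> polar_boundary" and e: "x /\<^sub>R norm x = y /\<^sub>R norm y" for x y
      proof -
        obtain z where z: "z \<in> D" "x \<bullet> z = 1" using x by (auto simp: polar_boundary_def)
        have "y \<bullet> z \<le> 1" using y z by (auto simp: polar_boundary_def)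
        moreover have "(x \<bullet> z) / norm x = (y \<bullet> z) / norm y"
          using arg_cong[OF e, of "\<lambda>u. u \<bullet> z"] by (simp add: divide_inverse mult.commute)
        ultimately show ?thesis using z nz[OF x] nz[OF y] by (simp add: field_simps)
      qed
      then have "norm x = norm y" using xy by (metis order_antisym)
      with xy(3) nz[OF xy(2)] show "x = y" by simp
    qed
    show "(\<lambda>y. y /\<^sub>R norm y) ` polar_boundary = sphere 0 1 \<inter> V"
    proof
      show "(\<lambda>y. y /\<^sub>R norm y) ` polar_boundary \<subseteq> sphere 0 1 \<inter> V"
      proof (rule image_subsetI)
        fix y assume y: "y \<in> polar_boundary"
        then have "y /\<^sub>R norm y \<in> V" using subspace_V by (simp add: polar_boundary_def subspace_scale)
        then show "y /\<^sub>R norm y \<in> sphere 0 1 \<inter> V" using nz[OF y] by simp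
      qed
      show "sphere 0 1 \<inter> V \<subseteq> (\<lambda>y. y /\<^sub>R norm y) ` polar_boundary"
      proof
        fix u assume "u \<in> sphere 0 1 \<inter> V"
        then have u: "norm u = 1" "u \<in> V" by auto
        obtain z where z: "z \<in> D" "\<And>z'. z' \<in> D \<Longrightarrow> u \<bullet> z' \<le> u \<bullet> z"
          using continuous_attains_sup[OF compact_D, of "\<lambda>z. u \<bullet> z"] zero_in_D
            continuous_on_inner[OF continuous_on_const continuous_on_id, of D u] by blast
        obtain e where e: "e > 0" "e *\<^sub>R u \<in> D"
        proof -
          \<comment> \<open>\<open>M\<close> bounds every \<open>w i \<bullet> u\<close>; the added
            1 keeps it positive even when all these products vanish or \<open>I\<close> is
            empty.\<close>
          define M where "M = (\<Sum>i\<in>I. \<bar>w i \<bullet> u\<bar>) + 1"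
          have "w i \<bullet> u \<le> M" if "i \<in> I" for i
            using member_le_sum[of i I "\<lambda>i. \<bar>w i \<bullet> u\<bar>"] finite_I that by (auto simp: M_def)
          moreover have "M > 0" by (simp add: M_def add_nonneg_pos sum_nonneg)
          ultimately have "(1 / M) *\<^sub>R u \<in> D" "1 / M > 0"
            using u subspace_V by (auto simp: D_eq subspace_scale field_simps)
          then show ?thesis using that by blast
        qed
        \<comment> \<open>\<open>u \<bullet> z\<close> is the maximum of \<open>u\<close> over
          \<open>D\<close>. It is positive because \<open>D\<close> contains a positive multiple of
          \<open>u\<close>; dividing \<open>u\<close> by it gives the boundary point on the
          ray.\<close>
        have "u \<bullet> z > 0"
          using z(2)[OF e(2)] e(1) u(1) by (simp add: norm_eq_1)
        then have "u /\<^sub>R (u \<bullet> z) \<in> polar_boundary"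
          using z u subspace_V by (auto simp: polar_boundary_def subspace_scale field_simps)
        moreover have "u = (u /\<^sub>R (u \<bullet> z)) /\<^sub>R norm (u /\<^sub>R (u \<bullet> z))"
          using u \<open>u \<bullet> z > 0\<close> by simp
        ultimately show "u \<in> (\<lambda>y. y /\<^sub>R norm y) ` polar_boundary" by blast
      qed
    qed
  qed
qed

lemma core_homeomorphic_sphere: "geom_carrier core homeomorphic (sphere 0 1 \<inter> V)"
  using core_homeomorphism polar_boundary_homeomorphic_sphere homeomorphic_def homeomorphic_trans
  by metis

end

section \<open>Graded posets\<close>

text \<open>A maximal chain contains exactly one element of each rank from 0 to \<open>n\<close>:
  \<open>mono\<close> excludes repetitions, while \<open>bot\<close>, \<open>step\<close> and
  \<open>extend\<close> exclude gaps.\<close>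

lemma graded_by_rank:
  fixes rk :: "'a \<Rightarrow> nat"
  assumes trans: "transp_on A lt"
    and mono: "\<And>x y. x \<in> A \<Longrightarrow> y \<in> A \<Longrightarrow> lt x y \<Longrightarrow> rk x < rk y"
    and step: "\<And>x y. x \<in> A \<Longrightarrow> y \<in> A \<Longrightarrow> lt x y \<Longrightarrow>
      \<exists>z\<in>A. lt x z \<and> rk z = Suc (rk x) \<and> (z = y \<or> lt z y)"
    and bot: "b \<in> A" "rk b = 0" "\<And>x. x \<in> A \<Longrightarrow> x = b \<or> lt b x"
    and bound: "\<And>x. x \<in> A \<Longrightarrow> rk x \<le> n"
    and extend: "\<And>x. x \<in> A \<Longrightarrow> rk x < n \<Longrightarrow> \<exists>y\<in>A. lt x y"
  shows "graded_poset A lt n" "rank_function A lt n rk"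
proof -
  have tr: "lt x z" if "lt x y" "lt y z" "x \<in> A" "y \<in> A" "z \<in> A" for x y z
    using trans that unfolding transp_on_def by blast
  have irr: "\<not> lt x x" if "x \<in> A" for x
    using mono[OF that that] by blast
  have "card C = n + 1" if C: "pred_on.maxchain A lt C" for C
  proof -
    have CA: "C \<subseteq> A" and ch: "\<And>x y. x \<in> C \<Longrightarrow> y \<in> C \<Longrightarrow> x = y \<or> lt x y \<or> lt y x"
      using C unfolding pred_on.maxchain_def pred_on.chain_def by auto
    \<comment> \<open>Maximality is used only in this form: an element comparable with the whole
      chain belongs to it.\<close>
    have maxl: "z \<in> C" if z: "z \<in> A" "\<And>c. c \<in> C \<Longrightarrow> c = z \<or> lt c z \<or> lt z c" for z
    proof (rule ccontr)
      assume "z \<notin> C"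
      moreover have "pred_on.chain A lt (insert z C)"
        unfolding pred_on.chain_def using CA ch z by auto
      ultimately show False
        using C unfolding pred_on.maxchain_def by blast
    qed
    have inj: "inj_on rk C"
    proof (rule inj_onI)
      fix x y assume xy: "x \<in> C" "y \<in> C" "rk x = rk y"
      then show "x = y" using ch[OF xy(1,2)] mono[of x y] mono[of y x] CA by auto
    qed
    have "k \<le> n \<Longrightarrow> k \<in> rk ` C" for k
    proof (induction k)
      case 0
      have "b \<in> C" using bot CA by (intro maxl) auto
      then show ?case using bot(2) by force
    next
      case (Suc k)
      then obtain x where x: "x \<in> C" "rk x = k" by auto
      have xA: "x \<in> A" using x CA by blast
      have "\<exists>z\<in>A. lt x z \<and> rk z = Suc k \<and> (\<forall>c\<in>C. lt x c \<longrightarrow> z = c \<or> lt z c)"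
      proof (cases "\<exists>y\<in>C. lt x y")
        case True
        \<comment> \<open>\<open>y\<close> is the next element of the chain above \<open>x\<close>;
          the \<open>z\<close> of rank \<open>Suc k\<close> between them is comparable with the
          whole chain.\<close>
        then obtain y where y: "y \<in> C" "lt x y" "\<And>c. c \<in> C \<Longrightarrow> lt x c \<Longrightarrow> rk y \<le> rk c"
          using arg_min_nat_lemma[of "\<lambda>y. y \<in> C \<and> lt x y" _ rk] by (metis (no_types, lifting))
        have yA: "y \<in> A" using y CA by blast
        obtain z where z: "z \<in> A" "lt x z" "rk z = Suc k" "z = y \<or> lt z y"
          using step[OF xA yA y(2)] x(2) by blast
        have "z = c \<or> lt z c" if c: "c \<in> C" "lt x c" for c
        proof -
          have cA: "c \<in> A" using c CA by blast
          have "\<not> lt c y" using mono[OF cA yA] y(3)[OF c] by auto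
          then have "y = c \<or> lt y c" using ch[OF y(1) c(1)] by blast
          then show ?thesis using z(4) tr[of z y c] z(1) yA cA by blast
        qed
        with z show ?thesis by blast
      next
        case False
        \<comment> \<open>Here \<open>x\<close> is the top of the chain, so any element of rank
          \<open>Suc k\<close> above \<open>x\<close> extends it.\<close>
        obtain y where "y \<in> A" "lt x y" using extend[OF xA] x(2) Suc.prems by auto
        then show ?thesis using step[OF xA, of y] x(2) False by blast
      qed
      then obtain z where z: "z \<in> A" "lt x z" "rk z = Suc k"
        "\<And>c. c \<in> C \<Longrightarrow> lt x c \<Longrightarrow> z = c \<or> lt z c" by blast
      have "c = z \<or> lt c z \<or> lt z c" if c: "c \<in> C" for c
        using ch[OF c x(1)] z tr[of c x z] xA CA c by blast
      then have "z \<in> C" using maxl z(1) by blast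
      then show ?case using z(3) by force
    qed
    then have "rk ` C = {..n}" using bound CA by fastforce
    then show ?thesis using card_image[OF inj] by simp
  qed
  then show "graded_poset A lt n"
    using trans irr by (auto simp: graded_poset_def irreflp_on_def)
  show "rank_function A lt n rk"
    unfolding rank_function_def
  proof (intro conjI ballI allI impI)
    show "rk x = 0" if "x \<in> A" "\<nexists>y. y \<in> A \<and> lt y x" for x
      using that bot by blast
    show "rk y = rk x + 1" if "covers A lt x y" for x y
      using that step[of x y] unfolding covers_def by auto
    show "rk x = n" if "x \<in> A" "\<nexists>y. y \<in> A \<and> lt x y" for x
      using that extend[of x] bound[of x] by fastforce
  qed
qed

lemma graded_by_rank_transfer:
  fixes rk :: "'b \<Rightarrow> nat"
  assumes bij: "bij_betw f A B"
    and iso: "\<And>x y. x \<in> A \<Longrightarrow> y \<in> A \<Longrightarrow> ltA x y \<longleftrightarrow> lt (f x) (f y)"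
    and trans: "transp_on B lt"
    and mono: "\<And>x y. x \<in> B \<Longrightarrow> y \<in> B \<Longrightarrow> lt x y \<Longrightarrow> rk x < rk y"
    and step: "\<And>x y. x \<in> B \<Longrightarrow> y \<in> B \<Longrightarrow> lt x y \<Longrightarrow>
      \<exists>z\<in>B. lt x z \<and> rk z = Suc (rk x) \<and> (z = y \<or> lt z y)"
    and bot: "b \<in> B" "rk b = 0" "\<And>x. x \<in> B \<Longrightarrow> x = b \<or> lt b x"
    and bound: "\<And>x. x \<in> B \<Longrightarrow> rk x \<le> n"
    and extend: "\<And>x. x \<in> B \<Longrightarrow> rk x < n \<Longrightarrow> \<exists>y\<in>B. lt x y"
  shows "graded_poset A ltA n" "rank_function A ltA n (rk \<circ> f)"
proof -
  define g where "g = inv_into A f"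
  have fB: "f x \<in> B" "g (f x) = x" if "x \<in> A" for x
    using that bij by (auto simp: g_def bij_betw_def)
  have gA: "g y \<in> A" "f (g y) = y" if "y \<in> B" for y
    using that bij by (auto simp: g_def bij_betw_def inv_into_into f_inv_into_f)
  have "transp_on A ltA"
    using trans iso fB unfolding transp_on_def by blast
  moreover have "(rk \<circ> f) x < (rk \<circ> f) y" if "x \<in> A" "y \<in> A" "ltA x y" for x y
    using that mono iso fB by auto
  moreover have "\<exists>z\<in>A. ltA x z \<and> (rk \<circ> f) z = Suc ((rk \<circ> f) x) \<and> (z = y \<or> ltA z y)"
    if xy: "x \<in> A" "y \<in> A" "ltA x y" for x y
  proof -
    obtain z where "z \<in> B" "lt (f x) z" "rk z = Suc (rk (f x))" "z = f y \<or> lt z (f y)"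
      using step[of "f x" "f y"] fB xy iso by auto
    then show ?thesis
      using xy iso fB gA by (intro bexI[of _ "g z"]) auto
  qed
  moreover have "g b \<in> A" "(rk \<circ> f) (g b) = 0" using bot gA by auto
  moreover have "x = g b \<or> ltA (g b) x" if "x \<in> A" for x
    using bot(3)[OF fB(1)[OF that]] fB gA bot(1) iso that by force
  moreover have "(rk \<circ> f) x \<le> n" if "x \<in> A" for x
    using that bound fB by auto
  moreover have "\<exists>y\<in>A. ltA x y" if x: "x \<in> A" "(rk \<circ> f) x < n" for x
  proof -
    obtain y where "y \<in> B" "lt (f x) y" using extend[of "f x"] fB x by auto
    then show ?thesis using gA iso x by (intro bexI[of _ "g y"]) auto
  qed
  ultimately show "graded_poset A ltA n" "rank_function A ltA n (rk \<circ> f)"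
    using graded_by_rank[of A ltA "rk \<circ> f" "g b" n] by blast+
qed

section \<open>The complex of a polytope\<close>

locale indexed_polytope =
  fixes P :: "'a::euclidean_space set" and \<F> :: "nat \<Rightarrow> 'a set" and n m :: nat
  assumes polytope_P: "polytope P" and aff_dim_P: "aff_dim P = int n"
    and facets: "bij_betw \<F> {1..m} {F. F facet_of P}"
begin

abbreviation \<sigma> :: "'a set \<Rightarrow> nat set" where
  "\<sigma> \<equiv> facet_indices m \<F>"

abbreviation K :: "nat set set" where
  "K \<equiv> polytope_complex P m \<F>"

section \<open>Faces and the facets containing them\<close>

lemma convex_P: "convex P"
  by (rule polytope_imp_convex[OF polytope_P])

lemma P_in_faces: "P \<in> faces P"
  using aff_dim_P convex_P by (auto simp: faces_def face_of_refl)

lemma facet: "i \<in> {1..m} \<Longrightarrow> \<F> i facet_of P"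
  using facets by (auto simp: bij_betw_def)

lemma facet_index:
  assumes "F facet_of P"
  obtains i where "i \<in> {1..m}" "F = \<F> i"
proof -
  have "F \<in> \<F> ` {1..m}" using facets assms by (simp add: bij_betw_def)
  with that show ?thesis by blast
qed

lemma \<sigma>_subset: "\<sigma> F \<subseteq> {1..m}"
  by (auto simp: facet_indices_def)

lemma faces_face: "F face_of P" "F \<noteq> {}" "F \<subseteq> P" "polytope F" "convex F" "compact F"
  if "F \<in> faces P"
proof -
  show "F face_of P" "F \<noteq> {}" using that by (auto simp: faces_def)
  then show "F \<subseteq> P" "polytope F"
    using polytope_P face_of_polytope_polytope face_of_imp_subset by blast+
  then show "convex F" "compact F"
    by (simp_all add: polytope_imp_convex polytope_imp_compact)
qed

text \<open>A proper face of a polyhedron is the intersection of the facets containing it. The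
  factor \<open>P\<close> covers the face \<open>P\<close>, which lies in no facet.\<close>

lemma face_eq_Int:
  assumes F: "F \<in> faces P"
  shows "F = P \<inter> (\<Inter>i\<in>\<sigma> F. \<F> i)"
proof (cases "F = P")
  case True
  then show ?thesis by (auto simp: facet_indices_def)
next
  case False
  have "F = \<Inter>{G. G facet_of P \<and> F \<subseteq> G}"
    using face_of_polyhedron[OF polytope_imp_polyhedron[OF polytope_P]] faces_face[OF F] False by blast
  moreover have "(\<Inter>i\<in>\<sigma> F. \<F> i) \<subseteq> \<Inter>{G. G facet_of P \<and> F \<subseteq> G}"
  proof (intro Inter_greatest, clarify)
    fix G x assume G: "G facet_of P" "F \<subseteq> G" and x: "x \<in> (\<Inter>i\<in>\<sigma> F. \<F> i)"
    obtain i where "i \<in> {1..m}" "G = \<F> i" using facet_index[OF G(1)] .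
    then show "x \<in> G" using G(2) x by (simp add: facet_indices_def)
  qed
  moreover have "F \<subseteq> P \<inter> (\<Inter>i\<in>\<sigma> F. \<F> i)"
    using faces_face(3)[OF F] by (auto simp: facet_indices_def)
  ultimately show ?thesis by blast
qed

lemma \<sigma>_subset_iff:
  assumes "F \<in> faces P" "G \<in> faces P"
  shows "\<sigma> G \<subseteq> \<sigma> F \<longleftrightarrow> F \<subseteq> G"
proof
  assume "\<sigma> G \<subseteq> \<sigma> F"
  then show "F \<subseteq> G"
    using face_eq_Int[OF assms(1)] face_eq_Int[OF assms(2)] by blast
qed (auto simp: facet_indices_def)

lemma inj_on_\<sigma>: "inj_on \<sigma> (faces P)"
  using \<sigma>_subset_iff by (intro inj_onI) (metis order_refl subset_antisym)

text \<open>The second claim is only an inclusion, since further facets may contain the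
  intersection.\<close>

lemma face_of_indices:
  assumes "\<tau> \<subseteq> {1..m}" "x \<in> P" "\<And>i. i \<in> \<tau> \<Longrightarrow> x \<in> \<F> i"
  shows "P \<inter> (\<Inter>i\<in>\<tau>. \<F> i) \<in> faces P" "\<tau> \<subseteq> \<sigma> (P \<inter> (\<Inter>i\<in>\<tau>. \<F> i))"
proof -
  have "\<Inter>(insert P (\<F> ` \<tau>)) face_of P"
  proof (rule face_of_Inter)
    show "T face_of P" if "T \<in> insert P (\<F> ` \<tau>)" for T
      using that assms(1) facet facet_of_imp_face_of face_of_refl[OF convex_P] by blast
  qed simp
  then show "P \<inter> (\<Inter>i\<in>\<tau>. \<F> i) \<in> faces P"
    using assms by (auto simp: faces_def)
  show "\<tau> \<subseteq> \<sigma> (P \<inter> (\<Inter>i\<in>\<tau>. \<F> i))"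
    using assms by (auto simp: facet_indices_def)
qed

section \<open>The simplices of \<open>K\<close>\<close>

lemma abs_complex_faces: "abs_complex {\<tau>. \<exists>F\<in>faces P. \<tau> \<subseteq> \<sigma> F}"
proof -
  have "finite {\<tau>. \<exists>F\<in>faces P. \<tau> \<subseteq> \<sigma> F}"
    by (rule finite_subset[of _ "Pow {1..m}"]) (auto simp: facet_indices_def)
  moreover have "finite \<tau>" if "\<tau> \<subseteq> \<sigma> F" for \<tau> F
    using that \<sigma>_subset finite_subset by (metis finite_atLeastAtMost)
  ultimately show ?thesis
    using P_in_faces unfolding abs_complex_def by blast
qed

text \<open>The downward closure of the hypergraph is itself a complex and lies in every complex
  containing the hypergraph.\<close>

lemma K_eq_faces: "K = {\<tau>. \<exists>F\<in>faces P. \<tau> \<subseteq> \<sigma> F}"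
  unfolding polytope_complex_def
proof (rule hull_unique)
  show "polytope_hypergraph P m \<F> \<subseteq> {\<tau>. \<exists>F\<in>faces P. \<tau> \<subseteq> \<sigma> F}"
    by (auto simp: polytope_hypergraph_def)
  show "{\<tau>. \<exists>F\<in>faces P. \<tau> \<subseteq> \<sigma> F} \<subseteq> L"
    if "polytope_hypergraph P m \<F> \<subseteq> L" "abs_complex L" for L
    using that by (auto simp: polytope_hypergraph_def abs_complex_def)
qed (rule abs_complex_faces)

lemma abs_complex_K: "abs_complex K"
  unfolding K_eq_faces by (rule abs_complex_faces)

lemma K_iff: "\<tau> \<in> K \<longleftrightarrow> \<tau> \<subseteq> {1..m} \<and> (\<exists>x\<in>P. \<forall>i\<in>\<tau>. x \<in> \<F> i)"
proof
  assume "\<tau> \<in> K"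
  then obtain F where F: "F \<in> faces P" "\<tau> \<subseteq> \<sigma> F" by (auto simp: K_eq_faces)
  obtain x where "x \<in> F" using faces_face[OF F(1)] by auto
  then show "\<tau> \<subseteq> {1..m} \<and> (\<exists>x\<in>P. \<forall>i\<in>\<tau>. x \<in> \<F> i)"
    using F faces_face(3)[OF F(1)] by (auto simp: facet_indices_def)
next
  assume "\<tau> \<subseteq> {1..m} \<and> (\<exists>x\<in>P. \<forall>i\<in>\<tau>. x \<in> \<F> i)"
  then show "\<tau> \<in> K"
    using face_of_indices[of \<tau>] unfolding K_eq_faces by blast
qed

section \<open>Vertices, maximal simplices and face simplices\<close>

lemma vertex_of_face:
  assumes F: "F \<in> faces P"
  obtains v where "v \<in> F" "{v} \<in> faces P"
proof -
  obtain v where v: "v extreme_point_of F"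
    using extreme_point_exists_convex faces_face[OF F] by metis
  then have "{v} face_of P"
    using faces_face(1)[OF F] face_of_trans face_of_singleton by blast
  then show ?thesis using that v by (auto simp: faces_def extreme_point_of_def)
qed

text \<open>By Krein-Milman a face is the convex hull of its extreme points, which are vertices of
  \<open>P\<close>.\<close>

lemma face_subset_convex:
  assumes F: "F \<in> faces P" and "convex G" and "\<And>v. v \<in> F \<Longrightarrow> {v} \<in> faces P \<Longrightarrow> v \<in> G"
  shows "F \<subseteq> G"
proof -
  have "F = convex hull {x. x extreme_point_of F}"
    using Krein_Milman_Minkowski faces_face[OF F] by blast
  moreover have "{x. x extreme_point_of F} \<subseteq> G"
  proof clarify
    fix v assume v: "v extreme_point_of F"
    then have "{v} face_of P"
      using faces_face(1)[OF F] face_of_trans face_of_singleton by blast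
    then show "v \<in> G" using assms(3) v by (auto simp: faces_def extreme_point_of_def)
  qed
  ultimately show ?thesis using hull_minimal[of _ G convex] \<open>convex G\<close> by metis
qed

text \<open>\<open>\<sigma>\<close> reverses inclusion, so its maximal values belong to the minimal
  faces, the vertices.\<close>

lemma max_simplices_K: "max_simplices K = {\<sigma> {v} | v. {v} \<in> faces P}"
proof (intro set_eqI iffI)
  fix \<tau> assume \<tau>: "\<tau> \<in> max_simplices K"
  then obtain F where F: "F \<in> faces P" "\<tau> \<subseteq> \<sigma> F" by (auto simp: max_simplices_def K_eq_faces)
  obtain v where v: "v \<in> F" "{v} \<in> faces P" using vertex_of_face[OF F(1)] .
  then have "\<tau> \<subseteq> \<sigma> {v}" using F by (auto simp: facet_indices_def)
  moreover have "\<sigma> {v} \<in> K" using v by (auto simp: K_eq_faces)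
  ultimately have "\<tau> = \<sigma> {v}" using \<tau> by (auto simp: max_simplices_def)
  with v show "\<tau> \<in> {\<sigma> {v} | v. {v} \<in> faces P}" by blast
next
  fix \<tau> assume "\<tau> \<in> {\<sigma> {v} | v. {v} \<in> faces P}"
  then obtain v where v: "{v} \<in> faces P" "\<tau> = \<sigma> {v}" by auto
  have "\<rho> = \<tau>" if "\<rho> \<in> K" "\<tau> \<subseteq> \<rho>" for \<rho>
  proof -
    obtain F where F: "F \<in> faces P" "\<rho> \<subseteq> \<sigma> F" using \<open>\<rho> \<in> K\<close> by (auto simp: K_eq_faces)
    have "F \<subseteq> {v}" using \<sigma>_subset_iff[OF F(1) v(1)] v(2) that F by auto
    then have "F = {v}" using faces_face(2)[OF F(1)] by auto
    then show ?thesis using F v that by auto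
  qed
  then show "\<tau> \<in> max_simplices K"
    using v by (auto simp: max_simplices_def K_eq_faces)
qed

text \<open>If \<open>\<tau>\<close> is an intersection of sets \<open>\<sigma> {v}\<close>, these
  vertices lie in the face \<open>F\<close> cut out by \<open>\<tau>\<close>, so
  \<open>\<sigma> F\<close> lies in each of the sets and equals \<open>\<tau>\<close>. Conversely, a
  facet is convex and contains \<open>F\<close> once it contains the vertices of
  \<open>F\<close>.\<close>

lemma face_simplices_K: "face_simplices K = polytope_hypergraph P m \<F>"
proof (intro set_eqI iffI)
  fix \<tau> assume "\<tau> \<in> face_simplices K"
  then obtain S where S: "\<tau> \<in> K" "S \<subseteq> max_simplices K" "S \<noteq> {}" "\<tau> = \<Inter>S"
    by (auto simp: face_simplices_def)
  obtain x where x: "\<tau> \<subseteq> {1..m}" "x \<in> P" "\<And>i. i \<in> \<tau> \<Longrightarrow> x \<in> \<F> i"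
    using S(1) by (auto simp: K_iff)
  define F where "F = P \<inter> (\<Inter>i\<in>\<tau>. \<F> i)"
  have F: "F \<in> faces P" "\<tau> \<subseteq> \<sigma> F" using face_of_indices[OF x] by (simp_all add: F_def)
  have "\<sigma> F \<subseteq> s" if s: "s \<in> S" for s
  proof -
    obtain v where v: "{v} \<in> faces P" "s = \<sigma> {v}"
      using S(2) s unfolding max_simplices_K by blast
    have "\<tau> \<subseteq> \<sigma> {v}" using S(4) s v by auto
    then have "v \<in> F" using faces_face(3)[OF v(1)] by (auto simp: F_def facet_indices_def)
    then show ?thesis using v by (auto simp: facet_indices_def)
  qed
  then have "\<tau> = \<sigma> F" using F(2) S(4) by blast
  with F show "\<tau> \<in> polytope_hypergraph P m \<F>" by (auto simp: polytope_hypergraph_def)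
next
  fix \<tau> assume "\<tau> \<in> polytope_hypergraph P m \<F>"
  then obtain F where F: "F \<in> faces P" "\<tau> = \<sigma> F" by (auto simp: polytope_hypergraph_def)
  define S where "S = {\<sigma> {v} | v. v \<in> F \<and> {v} \<in> faces P}"
  have "S \<subseteq> max_simplices K" by (auto simp: S_def max_simplices_K)
  moreover from this have "finite S"
    using abs_complex_K by (auto simp: abs_complex_def max_simplices_def intro: finite_subset)
  moreover have "S \<noteq> {}" using vertex_of_face[OF F(1)] by (auto simp: S_def)
  moreover have "\<tau> = \<Inter>S"
  proof
    show "\<tau> \<subseteq> \<Inter>S" using F by (auto simp: S_def facet_indices_def)
    show "\<Inter>S \<subseteq> \<tau>"
    proof
      fix i assume i: "i \<in> \<Inter>S"
      then have "i \<in> {1..m}" using \<open>S \<noteq> {}\<close> by (auto simp: S_def facet_indices_def)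
      moreover have "F \<subseteq> \<F> i"
      proof (rule face_subset_convex[OF F(1)])
        show "convex (\<F> i)"
          using facet[OF \<open>i \<in> {1..m}\<close>] facet_of_imp_face_of face_of_imp_convex by blast
        show "v \<in> \<F> i" if "v \<in> F" "{v} \<in> faces P" for v
          using i that by (auto simp: S_def facet_indices_def)
      qed
      ultimately show "i \<in> \<tau>" using F by (simp add: facet_indices_def)
    qed
  qed
  moreover have "\<tau> \<in> K" using F by (auto simp: K_eq_faces)
  ultimately show "\<tau> \<in> face_simplices K" by (auto simp: face_simplices_def)
qed

lemma empty_in_hypergraph: "{} \<in> polytope_hypergraph P m \<F>"
proof -
  have "\<not> P \<subseteq> \<F> i" if "i \<in> {1..m}" for i
    using facet[OF that] facet_of_imp_subset facet_of_irrefl by (metis subset_antisym)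
  then have "\<sigma> P = {}" by (auto simp: facet_indices_def)
  then show ?thesis using P_in_faces by (force simp: polytope_hypergraph_def)
qed

text \<open>No facet contains another one, because both have the same dimension. This makes
  \<open>K\<close> reduced.\<close>

lemma singleton_in_hypergraph:
  assumes "i \<in> {1..m}"
  shows "{i} \<in> polytope_hypergraph P m \<F>"
proof -
  have "j = i" if "j \<in> {1..m}" "\<F> i \<subseteq> \<F> j" for j
  proof -
    have "\<F> i face_of \<F> j"
      using facet[OF assms] facet[OF that(1)] that(2) face_of_subset
      by (meson facet_of_imp_face_of facet_of_imp_subset)
    moreover have "aff_dim (\<F> i) = aff_dim (\<F> j)"
      using facet[OF assms] facet[OF that(1)] by (simp add: facet_of_def)
    ultimately have "\<F> i = \<F> j"
      using face_of_aff_dim_lt[of "\<F> j" "\<F> i"] facet[OF that(1)]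
        face_of_imp_convex facet_of_imp_face_of by fastforce
    then show ?thesis
      using inj_onD[OF bij_betw_imp_inj_on[OF facets]] assms that(1) by metis
  qed
  then have "\<sigma> (\<F> i) = {i}" using assms by (auto simp: facet_indices_def)
  moreover have "\<F> i \<in> faces P"
    using facet[OF assms] by (auto simp: faces_def facet_of_def)
  ultimately show ?thesis by (force simp: polytope_hypergraph_def)
qed

section \<open>Grading of the faces by codimension\<close>

definition rk :: "'a set \<Rightarrow> nat" where
  "rk F = nat (int n - aff_dim F)"

lemma aff_dim_face: "0 \<le> aff_dim F" "aff_dim F \<le> int n" if "F \<in> faces P"
  using faces_face(2,3)[OF that] aff_dim_subset[of F P] aff_dim_P aff_dim_negative_iff[of F]
  by (simp_all add: not_less[symmetric])

lemma aff_dim_mono: "aff_dim G < aff_dim F" if "F \<in> faces P" "G \<in> faces P" "G \<subset> F"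
proof -
  have "G face_of F" using that faces_face face_of_subset by (metis psubset_imp_subset)
  then show ?thesis using face_of_aff_dim_lt faces_face(5) that by blast
qed

lemma face_step:
  assumes F: "F \<in> faces P" and G: "G \<in> faces P" and "G \<subset> F"
  obtains H where "H \<in> faces P" "G \<subseteq> H" "H \<subset> F" "aff_dim H = aff_dim F - 1"
proof -
  have "G face_of F" using assms faces_face face_of_subset by (metis psubset_imp_subset)
  then obtain H where H: "H facet_of F" "G \<subseteq> H"
    using face_of_polyhedron_subset_facet[OF polytope_imp_polyhedron[OF faces_face(4)[OF F]]]
      faces_face(2)[OF G] \<open>G \<subset> F\<close> by blast
  have "H \<in> faces P"
    using H faces_face(1)[OF F] face_of_trans by (auto simp: faces_def facet_of_def)
  moreover have "H \<subset> F"
    using H facet_of_imp_subset facet_of_irrefl by blast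
  ultimately show ?thesis using that H by (auto simp: facet_of_def)
qed

text \<open>Under reverse inclusion \<open>P\<close> is the bottom and the vertices have rank
  \<open>n\<close>. The bijection \<open>f\<close> allows the use for the faces themselves and for
  the face simplices.\<close>

lemma graded_transfer:
  assumes "bij_betw f A (faces P)"
    and "\<And>x y. x \<in> A \<Longrightarrow> y \<in> A \<Longrightarrow> lt x y \<longleftrightarrow> f y \<subset> f x"
  shows "graded_poset A lt n" "rank_function A lt n (rk \<circ> f)"
proof -
  have 1: "transp_on (faces P) (\<lambda>F G. G \<subset> F)" by (auto simp: transp_on_def)
  have 2: "rk F < rk G" if "F \<in> faces P" "G \<in> faces P" "G \<subset> F" for F G
    using aff_dim_mono[OF that] aff_dim_face[OF that(1)] by (auto simp: rk_def)
  have 3: "\<exists>H\<in>faces P. H \<subset> F \<and> rk H = Suc (rk F) \<and> (H = G \<or> G \<subset> H)"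
    if FG: "F \<in> faces P" "G \<in> faces P" "G \<subset> F" for F G
  proof -
    obtain H where H: "H \<in> faces P" "G \<subseteq> H" "H \<subset> F" "aff_dim H = aff_dim F - 1"
      using face_step[OF FG] .
    then have "rk H = Suc (rk F)"
      using aff_dim_face[OF FG(1)] by (auto simp: rk_def)
    with H show ?thesis by blast
  qed
  have 4: "rk P = 0" "F \<in> faces P \<Longrightarrow> F = P \<or> F \<subset> P" "F \<in> faces P \<Longrightarrow> rk F \<le> n" for F
    using aff_dim_P faces_face(3)[of F] aff_dim_face[of F] by (auto simp: rk_def nat_le_iff)
  have 5: "\<exists>G\<in>faces P. G \<subset> F" if F: "F \<in> faces P" "rk F < n" for F
  proof -
    obtain v where v: "v \<in> F" "{v} \<in> faces P" using vertex_of_face[OF F(1)] .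
    \<comment> \<open>A single point has dimension 0 and therefore rank \<open>n\<close>.\<close>
    have "F \<noteq> {v}" using F(2) by (auto simp: rk_def)
    then show ?thesis using v by blast
  qed
  show "graded_poset A lt n" "rank_function A lt n (rk \<circ> f)"
    by (rule graded_by_rank_transfer[OF assms 1 2 3 P_in_faces 4 5]; assumption)+
qed

section \<open>The link of a face simplex\<close>

lemma link_core:
  assumes F: "F \<in> faces P"
  shows "\<exists>Z. abs_complex Z \<and> Z \<subseteq> link K (\<sigma> F) \<and>
    geom_realization Z homeomorphic_space sphere_space (aff_dim F - 1) \<and>
    geom_carrier Z strong_deformation_retract_of geom_realization (link K (\<sigma> F))"
proof -
  note FF = faces_face[OF F]
  obtain c where c: "c \<in> rel_interior F"
    using rel_interior_eq_empty[OF FF(5)] FF(2) by blast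
  then have cF: "c \<in> F" using rel_interior_subset by blast
  \<comment> \<open>The direction space of \<open>F\<close>, of dimension \<open>aff_dim F\<close>;
    the sphere sought is its unit sphere.\<close>
  define V where "V = (\<lambda>x. - c + x) ` (affine hull F)"
  have V: "subspace V"
    unfolding V_def using cF by (intro affine_diffs_subspace) (auto intro: hull_inc)
  have V_iff: "z \<in> V \<longleftrightarrow> c + z \<in> affine hull F" for z
    unfolding V_def by (auto intro!: image_eqI[of _ _ "c + z"])
  have dimV: "aff_dim F = int (dim V)"
    using aff_dim_eq_dim[of c "affine hull F"] cF unfolding V_def
    by (simp add: hull_inc)
  \<comment> \<open>The facets not containing \<open>F\<close>. Some of them may miss
    \<open>F\<close> altogether; these are not vertices of the nerve.\<close>
  define I where "I = {1..m} - \<sigma> F"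
  have "\<forall>i\<in>{1..m}. \<exists>a b. P \<subseteq> {x. a \<bullet> x \<le> b} \<and> \<F> i = P \<inter> {x. a \<bullet> x = b}"
    using facet_of_polyhedron[OF polytope_imp_polyhedron[OF polytope_P] facet] by metis
  then obtain a b where ab: "\<And>i. i \<in> {1..m} \<Longrightarrow> P \<subseteq> {x. a i \<bullet> x \<le> b i}"
    "\<And>i. i \<in> {1..m} \<Longrightarrow> \<F> i = P \<inter> {x. a i \<bullet> x = b i}"
    by metis
  have c_less: "a i \<bullet> c < b i" if "i \<in> I" for i
  proof -
    have i: "i \<in> {1..m}" "\<not> F \<subseteq> \<F> i" using that by (auto simp: I_def facet_indices_def)
    \<comment> \<open>A face of \<open>P\<close> that meets the relative interior of
      \<open>F\<close> contains \<open>F\<close>.\<close>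
    have "c \<notin> \<F> i"
      using subset_of_face_of[OF facet_of_imp_face_of[OF facet[OF i(1)]] FF(3)] i(2) c by blast
    then have "a i \<bullet> c \<noteq> b i" "a i \<bullet> c \<le> b i" using ab[OF i(1)] cF FF(3) by auto
    then show ?thesis by simp
  qed
  \<comment> \<open>The normal of each facet is projected to \<open>V\<close> and divided by the
    slack at \<open>c\<close>, so that its inequality becomes
    \<open>w i \<bullet> z \<le> 1\<close>. The slack is known to be positive only for
    \<open>i\<close> in \<open>I\<close>; division by 0 gives 0.\<close>
  have "\<exists>u\<in>V. \<forall>v\<in>V. u \<bullet> v = (a i \<bullet> v) / (b i - a i \<bullet> c)" for i
  proof -
    obtain y z where yz: "y \<in> V" "\<And>v. v \<in> V \<Longrightarrow> orthogonal z v" "a i = y + z"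
      using orthogonal_subspace_decomp_exists[of V "a i"] V by (metis span_eq_iff)
    have "((1 / (b i - a i \<bullet> c)) *\<^sub>R y) \<bullet> v = (a i \<bullet> v) / (b i - a i \<bullet> c)" if "v \<in> V" for v
      using yz(2)[OF that] yz(3) by (simp add: orthogonal_def inner_add_left)
    then show ?thesis using yz(1) V by (blast intro: subspace_scale)
  qed
  then obtain w where wV: "\<And>i. w i \<in> V"
    and w: "\<And>i v. v \<in> V \<Longrightarrow> w i \<bullet> v = (a i \<bullet> v) / (b i - a i \<bullet> c)"
    by metis
  have w_le: "w i \<bullet> z \<le> 1 \<longleftrightarrow> a i \<bullet> (c + z) \<le> b i"
    and w_eq: "w i \<bullet> z = 1 \<longleftrightarrow> a i \<bullet> (c + z) = b i" if "i \<in> I" "z \<in> V" for i z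
    unfolding w[OF that(2)] using c_less[OF that(1)]
    by (simp_all add: divide_le_eq divide_eq_eq inner_add_right algebra_simps)
  have w_face: "w i \<bullet> z = 1 \<longleftrightarrow> c + z \<in> \<F> i" if "i \<in> I" "c + z \<in> F" for i z
    using that w_eq[of i z] ab(2)[of i] FF(3) hull_subset[of F affine]
    by (auto simp: I_def V_iff)
  define D where "D = (\<lambda>x. - c + x) ` F"
  have D_iff: "z \<in> D \<longleftrightarrow> c + z \<in> F" for z
    unfolding D_def by (auto intro!: image_eqI[of _ _ "c + z"])
  have D_eq: "D = {z \<in> V. \<forall>i\<in>I. w i \<bullet> z \<le> 1}"
  proof (intro set_eqI iffI)
    fix z assume "z \<in> D"
    then have z: "c + z \<in> F" by (simp add: D_iff)
    then have "z \<in> V" using hull_subset[of F affine] by (auto simp: V_iff)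
    moreover have "w i \<bullet> z \<le> 1" if "i \<in> I" for i
      using w_le[OF that \<open>z \<in> V\<close>] ab(1)[of i] that z FF(3) by (auto simp: I_def)
    ultimately show "z \<in> {z \<in> V. \<forall>i\<in>I. w i \<bullet> z \<le> 1}" by simp
  next
    fix z assume "z \<in> {z \<in> V. \<forall>i\<in>I. w i \<bullet> z \<le> 1}"
    then have z: "z \<in> V" "\<And>i. i \<in> I \<Longrightarrow> w i \<bullet> z \<le> 1" by auto
    show "z \<in> D"
    proof (cases "z = 0")
      case True
      then show ?thesis using cF by (simp add: D_iff)
    next
      case False
      \<comment> \<open>\<open>d\<close> is the time at which the ray from \<open>c\<close> towards
        \<open>c + z\<close> leaves \<open>F\<close>. The inequalities will give
        \<open>1 \<le> d\<close>, so \<open>c + z\<close> still lies in \<open>F\<close>.\<close>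
      obtain d where d: "0 < d" "c + d *\<^sub>R z \<in> rel_frontier F"
        "\<And>e. 0 \<le> e \<Longrightarrow> e < d \<Longrightarrow> c + e *\<^sub>R z \<in> rel_interior F"
        using ray_to_rel_frontier[of F c z] FF(6) compact_imp_bounded c z(1) False
        by (metis V_iff)
      have polyF: "polyhedron F" using FF(4) by (rule polytope_imp_polyhedron)
      obtain H where H: "H facet_of F" "c + d *\<^sub>R z \<in> H"
        using d(2) rel_frontier_of_polyhedron[OF polyF] by blast
      have HF: "H face_of F" "H \<noteq> F" using H facet_of_imp_face_of facet_of_irrefl by auto
      have HP: "H \<in> faces P"
        using H FF(1) face_of_trans by (auto simp: faces_def facet_of_def)
      have "c \<notin> H" using face_of_disjoint_rel_interior[OF HF] c by blast
      \<comment> \<open>\<open>H\<close> is cut out of \<open>P\<close> by facets, so one of them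
        contains \<open>H\<close> but not \<open>c\<close>. Its inequality is tight at the exit
        point.\<close>
      then obtain i where i: "i \<in> \<sigma> H" "c \<notin> \<F> i"
        using face_eq_Int[OF HP] cF FF(3) by blast
      then have iI: "i \<in> I" using cF by (auto simp: I_def facet_indices_def)
      have "c + d *\<^sub>R z \<in> \<F> i" using i H by (auto simp: facet_indices_def)
      moreover have "c + d *\<^sub>R z \<in> F" using H HF face_of_imp_subset by blast
      ultimately have "w i \<bullet> (d *\<^sub>R z) = 1" using w_face[OF iI] by blast
      then have "d * (w i \<bullet> z) = 1" by simp
      moreover have "d * (w i \<bullet> z) \<le> d * 1" using z(2)[OF iI] d(1) by (intro mult_left_mono) auto
      ultimately have "1 \<le> d" by simp
      then consider "d = 1" | "1 < d" by linarith
      then show ?thesis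
      proof cases
        case 1
        then show ?thesis using \<open>c + d *\<^sub>R z \<in> F\<close> by (simp add: D_iff)
      next
        case 2
        then have "c + z \<in> rel_interior F" using d(3)[of 1] by simp
        then show ?thesis using rel_interior_subset by (auto simp: D_iff)
      qed
    qed
  qed
  have bounded_D: "bounded D"
    unfolding D_def using FF(6) compact_imp_bounded bounded_translation by blast
  interpret polar_points V I w D
  proof
    show "finite I" by (simp add: I_def)
    show "w i \<in> V" for i by (rule wV)
    show "D = {z \<in> V. \<forall>i\<in>I. w i \<bullet> z \<le> 1}" by (rule D_eq)
  qed (rule V bounded_D)+
  have nerve_eq: "nerve = link K (\<sigma> F)"
  proof (intro set_eqI iffI)
    fix \<tau> assume "\<tau> \<in> nerve"
    then obtain z where z: "\<tau> \<subseteq> I" "z \<in> D" "\<And>i. i \<in> \<tau> \<Longrightarrow> w i \<bullet> z = 1"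
      by (auto simp: nerve_def)
    have zF: "c + z \<in> F" using z(2) by (simp add: D_iff)
    have "c + z \<in> \<F> i" if "i \<in> \<tau> \<union> \<sigma> F" for i
      using that z w_face[OF _ zF] zF by (auto simp: facet_indices_def)
    moreover have "\<tau> \<subseteq> {1..m}" "\<tau> \<inter> \<sigma> F = {}" using z(1) by (auto simp: I_def)
    moreover have "c + z \<in> P" using zF FF(3) by blast
    ultimately show "\<tau> \<in> link K (\<sigma> F)"
      using \<sigma>_subset by (auto simp: link_def K_iff)
  next
    fix \<tau> assume "\<tau> \<in> link K (\<sigma> F)"
    then have \<tau>: "\<tau> \<subseteq> I" "\<tau> \<union> \<sigma> F \<in> K" by (auto simp: link_def K_iff I_def)
    then obtain x where x: "x \<in> P" "\<And>i. i \<in> \<tau> \<union> \<sigma> F \<Longrightarrow> x \<in> \<F> i" by (auto simp: K_iff)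
    \<comment> \<open>The facets indexed by \<open>\<sigma> F\<close> cut \<open>F\<close> out of
      \<open>P\<close>.\<close>
    then have "x \<in> F" using face_eq_Int[OF F] by blast
    then have "x - c \<in> D" "\<forall>i\<in>\<tau>. w i \<bullet> (x - c) = 1"
      using w_face[of _ "x - c"] x \<tau>(1) by (auto simp: D_iff)
    then show "\<tau> \<in> nerve" using \<tau>(1) by (auto simp: nerve_def)
  qed
  have "geom_realization core homeomorphic_space sphere_space (aff_dim F - 1)"
    unfolding geom_realization_eq dimV
    using homeomorphic_space_trans[OF homeomorphic_imp_homeomorphic_space[OF core_homeomorphic_sphere]
        sphere_Int_subspace_homeomorphic_sphere_space[OF V]] .
  then show ?thesis
    using abs_complex_core core_subset core_deformation_retract unfolding nerve_eq by blast
qed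

lemma polytope_complex_properties:
  "polytopic_complex n K \<and> reduced_complex K \<and> face_simplices K = polytope_hypergraph P m \<F> \<and>
    graded_poset_isomorphic n (face_simplices K) (\<subset>) (faces P) (\<lambda>F G. G \<subset> F)"
proof -
  define f where "f = inv_into (faces P) \<sigma>"
  have f\<sigma>: "f (\<sigma> F) = F" if "F \<in> faces P" for F
    using that inj_on_\<sigma> by (simp add: f_def)
  have bij: "bij_betw f (face_simplices K) (faces P)"
    unfolding f_def face_simplices_K polytope_hypergraph_def
    by (intro bij_betw_inv_into inj_on_imp_bij_betw inj_on_\<sigma>)
  have iso: "x \<subset> y \<longleftrightarrow> f y \<subset> f x" if xy: "x \<in> face_simplices K" "y \<in> face_simplices K" for x y
  proof -
    obtain F G where "F \<in> faces P" "x = \<sigma> F" "G \<in> faces P" "y = \<sigma> G"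
      using xy by (auto simp: face_simplices_K polytope_hypergraph_def)
    then show ?thesis by (simp add: f\<sigma> psubset_eq \<sigma>_subset_iff inj_on_eq_iff[OF inj_on_\<sigma>]) blast
  qed
  have graded_K: "graded_poset (face_simplices K) (\<subset>) n"
    "rank_function (face_simplices K) (\<subset>) n (rk \<circ> f)"
    using graded_transfer[OF bij iso] by simp_all
  have graded_P: "graded_poset (faces P) (\<lambda>F G. G \<subset> F) n"
    "rank_function (faces P) (\<lambda>F G. G \<subset> F) n rk"
    using graded_transfer[of id "faces P" "\<lambda>F G. G \<subset> F"] by simp_all
  have "polytopic_complex n K"
    unfolding polytopic_complex_def
  proof (intro conjI exI[of _ "rk \<circ> f"] ballI)
    show "{} \<in> face_simplices K" by (simp add: face_simplices_K empty_in_hypergraph)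
    fix \<tau> assume "\<tau> \<in> face_simplices K"
    then obtain F where F: "F \<in> faces P" "\<tau> = \<sigma> F"
      by (auto simp: face_simplices_K polytope_hypergraph_def)
    \<comment> \<open>The rank is the codimension of \<open>F\<close>, so \<open>int n\<close> minus
      the rank is \<open>aff_dim F\<close>.\<close>
    have "int n - int ((rk \<circ> f) \<tau>) - 1 = aff_dim F - 1"
      using aff_dim_face[OF F(1)] F by (simp add: f\<sigma> rk_def)
    with link_core[OF F(1)] F(2)
    show "\<exists>Z. abs_complex Z \<and> Z \<subseteq> link K \<tau> \<and>
        geom_realization Z homeomorphic_space sphere_space (int n - int ((rk \<circ> f) \<tau>) - 1) \<and>
        geom_carrier Z strong_deformation_retract_of geom_realization (link K \<tau>)"
      by simp
  qed (use abs_complex_K graded_K in simp_all)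
  moreover have "reduced_complex K"
    unfolding reduced_complex_def vertices_def face_simplices_K
    using singleton_in_hypergraph by (auto simp: K_iff)
  moreover have "graded_poset_isomorphic n (face_simplices K) (\<subset>) (faces P) (\<lambda>F G. G \<subset> F)"
    unfolding graded_poset_isomorphic_def
    using graded_K graded_P bij iso
    by (intro conjI exI[of _ "rk \<circ> f"] exI[of _ rk] exI[of _ f]) simp_all
  ultimately show ?thesis using face_simplices_K by blast
qed

end

theorem lemma3:
  fixes P :: "'a::euclidean_space set" and \<F> :: "nat \<Rightarrow> 'a set" and n m :: nat
  assumes "polytope P"
    and "aff_dim P = int n"
    and "bij_betw \<F> {1..m} {F. F facet_of P}"
  shows "polytopic_complex n (polytope_complex P m \<F>) \<and>
    reduced_complex (polytope_complex P m \<F>) \<and>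
    face_simplices (polytope_complex P m \<F>) = polytope_hypergraph P m \<F> \<and>
    graded_poset_isomorphic n
      (face_simplices (polytope_complex P m \<F>)) (\<subset>)
      (faces P) (\<lambda>F G. G \<subset> F)"
proof -
  interpret indexed_polytope P \<F> n m
    using assms by unfold_locales
  show ?thesis by (rule polytope_complex_properties)
qed

end
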